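(* Let $X\neq\{0\}$ be a Banach space, let $t_0<t_1$ be real numbers, let $0<\alpha<\beta<1$, and let $f\in H^{0,\beta}_{t_0}([t_0,t_1];X)$. Then the fractional derivative $D^{\alpha}_{t_0,t}f(t)$ exists for all $t\in[t_0,t_1]$ and satisfies $$D^{\alpha}_{t_0,t}f(t)=\frac{-\alpha}{\Gamma(1-\alpha)}\int_{t_0}^{t}(t-s)^{-\alpha-1}[f(s)-f(t)]\,ds+\frac{(t-t_0)^{-\alpha}f(t)}{\Gamma(1-\alpha)}$$ for every $t\in(t_0,t_1]$, while for $t=t_0$ both sides vanish (the right-hand side being understood as its limit as $t\to t_0^+$). Consequently, the inclusion $$H^{0,\beta}_{t_0}([t_0,t_1];X)\subsetneq RL^{\alpha}([t_0,t_1];X)$$ holds and is continuous, i.e. there is $M>0$ with $\|f\|_{RL^\alpha([t_0,t_1];X)}\le M\|f\|_{H^{0,\beta}([t_0,t_1];X)}$ for all $f\in H^{0,\beta}_{t_0}([t_0,t_1];X)$.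
   Context: For $0<\alpha<1$: $J_{t_0,t}^{1-\alpha}f(t)=\frac{1}{\Gamma(1-\alpha)}\int_{t_0}^{t}(t-s)^{-\alpha}f(s)\,ds$ (Bochner integral) and the Riemann–Liouville fractional derivative is $D_{t_0,t}^{\alpha}f(t)=\frac{d}{dt}\big[J_{t_0,t}^{1-\alpha}f(t)\big]$; existence at a point $t$ means existence of this derivative as a limit of difference quotients (one-sided at the endpoints). The space $RL^{\alpha}([t_0,t_1];X)$ consists of all $f\in C^0([t_0,t_1];X)$ with $D_{t_0,t}^{\alpha}f\in C^0([t_0,t_1];X)$ (derivative in the weak sense, having a continuous representative), with norm $\|f\|_{RL^\alpha}=\|f\|_{C^0}+\|D^{\alpha}_{t_0,t}f\|_{C^0}$, where $\|\cdot\|_{C^0}$ is the supremum norm. For $\beta\in(0,1)$, $H^{0,\beta}([t_0,t_1];X)$ is the space of functions $f:[t_0,t_1]\to X$ with $\|f(t)-f(s)\|_X\le M|t-s|^{\beta}$ for all $t,s$ and some $M>0$, with norm $\|f\|_{C^0}+\sup_{t\ne s}\frac{\|f(t)-f(s)\|_X}{|t-s|^{\beta}}$; and $H^{0,\beta}_{t_0}([t_0,t_1];X)=\{f\in H^{0,\beta}([t_0,t_1];X): f(t_0)=0\}$. *)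

theory Defs
  imports "HOL-Analysis.Analysis"
begin

text \<open>
  The library's Bochner integral (\<^const>\<open>has_bochner_integral\<close>) is only available for second
  countable, i.e. separable, target spaces.  The following is the usual definition for an arbitrary
  Banach space: \<open>f\<close> is the a.e. limit and the \<open>L\<^sup>1\<close> limit of integrable simple functions, and the
  integral is the limit of their integrals.  It is applied below to complete measures only, for
  which the integrands \<open>norm (f x - s i x)\<close> are measurable.
\<close>

definition bochner_has_integral ::
  "'b measure \<Rightarrow> ('b \<Rightarrow> 'a::banach) \<Rightarrow> 'a \<Rightarrow> bool"
where
  "bochner_has_integral M f y \<longleftrightarrow>
     (\<exists>s :: nat \<Rightarrow> 'b \<Rightarrow> 'a.
        (\<forall>i. Bochner_Integration.simple_bochner_integrable M (s i)) \<and>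
        (AE x in M. (\<lambda>i. s i x) \<longlonglongrightarrow> f x) \<and>
        (\<lambda>i. \<integral>\<^sup>+x. ennreal (norm (f x - s i x)) \<partial>M) \<longlonglongrightarrow> 0 \<and>
        (\<lambda>i. Bochner_Integration.simple_bochner_integral M (s i)) \<longlonglongrightarrow> y)"

definition bochner_integrable :: "'b measure \<Rightarrow> ('b \<Rightarrow> 'a::banach) \<Rightarrow> bool" where
  "bochner_integrable M f \<longleftrightarrow> (\<exists>y. bochner_has_integral M f y)"

definition bochner_integral :: "'b measure \<Rightarrow> ('b \<Rightarrow> 'a::banach) \<Rightarrow> 'a" where
  "bochner_integral M f =
     (if bochner_integrable M f then THE y. bochner_has_integral M f y else 0)"

text \<open>
  Functions \<open>[t0,t1] \<rightarrow> X\<close> are represented by total functions on the reals of which only the values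
  on \<open>{t0..t1}\<close> matter; the function spaces below are sets closed under changing a function
  outside \<open>{t0..t1}\<close>.
\<close>

definition J_kernel :: "real \<Rightarrow> (real \<Rightarrow> 'a::banach) \<Rightarrow> real \<Rightarrow> real \<Rightarrow> 'a" where
  "J_kernel \<alpha> f t s = (t - s) powr (-\<alpha>) *\<^sub>R f s"

definition RL_integral :: "real \<Rightarrow> real \<Rightarrow> (real \<Rightarrow> 'a::banach) \<Rightarrow> real \<Rightarrow> 'a" where
  "RL_integral \<alpha> t0 f t =
     (1 / Gamma (1 - \<alpha>)) *\<^sub>R bochner_integral (lebesgue_on {t0..t}) (J_kernel \<alpha> f t)"

definition has_RL_derivative ::
  "real \<Rightarrow> real \<Rightarrow> real \<Rightarrow> (real \<Rightarrow> 'a::banach) \<Rightarrow> 'a \<Rightarrow> real \<Rightarrow> bool"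
where
  "has_RL_derivative \<alpha> t0 t1 f D t \<longleftrightarrow>
     (\<forall>\<tau>\<in>{t0..t1}. bochner_integrable (lebesgue_on {t0..\<tau>}) (J_kernel \<alpha> f \<tau>)) \<and>
     (RL_integral \<alpha> t0 f has_vector_derivative D) (at t within {t0..t1})"

definition test_functions :: "real \<Rightarrow> real \<Rightarrow> (real \<Rightarrow> real) set" where
  "test_functions a b =
     {\<phi>. (\<forall>n. (deriv ^^ n) \<phi> differentiable_on UNIV) \<and>
         (\<exists>K. compact K \<and> K \<subseteq> {a<..<b} \<and> (\<forall>x. x \<notin> K \<longrightarrow> \<phi> x = 0))}"

definition has_weak_derivative ::
  "real \<Rightarrow> real \<Rightarrow> (real \<Rightarrow> 'a::banach) \<Rightarrow> (real \<Rightarrow> 'a) \<Rightarrow> bool"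
where
  "has_weak_derivative a b u g \<longleftrightarrow>
     bochner_integrable (lebesgue_on {a..b}) u \<and>
     bochner_integrable (lebesgue_on {a..b}) g \<and>
     (\<forall>\<phi>\<in>test_functions a b.
        bochner_integral (lebesgue_on {a..b}) (\<lambda>t. deriv \<phi> t *\<^sub>R u t) =
        - bochner_integral (lebesgue_on {a..b}) (\<lambda>t. \<phi> t *\<^sub>R g t))"

definition is_cont_RL_derivative ::
  "real \<Rightarrow> real \<Rightarrow> real \<Rightarrow> (real \<Rightarrow> 'a::banach) \<Rightarrow> (real \<Rightarrow> 'a) \<Rightarrow> bool"
where
  "is_cont_RL_derivative \<alpha> t0 t1 f g \<longleftrightarrow>
     continuous_on {t0..t1} g \<and> has_weak_derivative t0 t1 (RL_integral \<alpha> t0 f) g"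

definition RL_space :: "real \<Rightarrow> real \<Rightarrow> real \<Rightarrow> (real \<Rightarrow> 'a::banach) set" where
  "RL_space \<alpha> t0 t1 =
     {f. continuous_on {t0..t1} f \<and> (\<exists>g. is_cont_RL_derivative \<alpha> t0 t1 f g)}"

definition C0_norm :: "real \<Rightarrow> real \<Rightarrow> (real \<Rightarrow> 'a::banach) \<Rightarrow> real" where
  "C0_norm t0 t1 f = (SUP t\<in>{t0..t1}. norm (f t))"

text \<open>
  The continuous representative is unique on \<open>{t0..t1}\<close>, so the norm does not depend on the choice.
\<close>

definition RL_norm :: "real \<Rightarrow> real \<Rightarrow> real \<Rightarrow> (real \<Rightarrow> 'a::banach) \<Rightarrow> real" where
  "RL_norm \<alpha> t0 t1 f =
     C0_norm t0 t1 f + C0_norm t0 t1 (SOME g. is_cont_RL_derivative \<alpha> t0 t1 f g)"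

definition Holder_space :: "real \<Rightarrow> real \<Rightarrow> real \<Rightarrow> (real \<Rightarrow> 'a::banach) set" where
  "Holder_space \<beta> t0 t1 =
     {f. \<exists>M>0. \<forall>t\<in>{t0..t1}. \<forall>s\<in>{t0..t1}. norm (f t - f s) \<le> M * \<bar>t - s\<bar> powr \<beta>}"

definition Holder_norm :: "real \<Rightarrow> real \<Rightarrow> real \<Rightarrow> (real \<Rightarrow> 'a::banach) \<Rightarrow> real" where
  "Holder_norm \<beta> t0 t1 f =
     C0_norm t0 t1 f +
     (SUP (t, s)\<in>{(t, s). t \<in> {t0..t1} \<and> s \<in> {t0..t1} \<and> t \<noteq> s}.
        norm (f t - f s) / \<bar>t - s\<bar> powr \<beta>)"

definition Holder_space0 :: "real \<Rightarrow> real \<Rightarrow> real \<Rightarrow> (real \<Rightarrow> 'a::banach) set" where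
  "Holder_space0 \<beta> t0 t1 = {f \<in> Holder_space \<beta> t0 t1. f t0 = 0}"

definition Marchaud_kernel :: "real \<Rightarrow> (real \<Rightarrow> 'a::banach) \<Rightarrow> real \<Rightarrow> real \<Rightarrow> 'a" where
  "Marchaud_kernel \<alpha> f t s = (t - s) powr (-\<alpha> - 1) *\<^sub>R (f s - f t)"

definition Marchaud_formula :: "real \<Rightarrow> real \<Rightarrow> (real \<Rightarrow> 'a::banach) \<Rightarrow> real \<Rightarrow> 'a" where
  "Marchaud_formula \<alpha> t0 f t =
     (-\<alpha> / Gamma (1 - \<alpha>)) *\<^sub>R bochner_integral (lebesgue_on {t0..t}) (Marchaud_kernel \<alpha> f t) +
     ((t - t0) powr (-\<alpha>) / Gamma (1 - \<alpha>)) *\<^sub>R f t"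

end

theory Submission
  imports Defs
begin

text \<open>
  Extend \<open>f\<close> to a Hoelder function \<open>h\<close> on the whole line that vanishes to the left of \<open>t0\<close>.  Cutting off
  the singularity of the kernel gives \<open>F\<^sub>\<epsilon> t = \<integral>\<^bsub>\<epsilon>\<^esub>\<^bsup>L\<^esup> u\<^bsup>-\<alpha>\<^esup> h (t - u) du\<close>, with \<open>L = t1 - t0\<close> not depending
  on \<open>t\<close> because \<open>h\<close> vanishes where \<open>u > t - t0\<close>.  Integration by parts against a primitive of \<open>h\<close>
  followed by differentiation under the integral sign yields \<open>F\<^sub>\<epsilon>'\<close>.  By the Hoelder condition it differs
  from \<open>\<Gamma>(1 - \<alpha>)\<close> times the asserted derivative by \<open>O(\<epsilon>\<^bsup>\<beta>-\<alpha>\<^esup>)\<close>, uniformly in \<open>t\<close>, so that the limits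
  \<open>\<epsilon> \<rightarrow> 0\<close> and \<open>d/dt\<close> may be exchanged.

  The inclusion is strict because \<open>(t - t0)\<^bsup>\<gamma>\<^esup> v\<close> with \<open>\<alpha> < \<gamma> < \<beta>\<close> is \<open>\<gamma>\<close>-Hoelder, hence in \<open>RL\<^sup>\<alpha>\<close> by
  the first part applied to \<open>\<gamma>\<close>, but not \<open>\<beta>\<close>-Hoelder.
\<close>

section \<open>The Bochner integral\<close>

text \<open>The integrals of \<open>s i\<close> and \<open>t i\<close> differ by at most the
  \<open>L1\<close> distance of \<open>s i\<close> to \<open>f\<close> plus that of
  \<open>t i\<close> to \<open>f\<close>, and both tend to 0. Splitting the integral of this sum
  needs measurable summands, which an arbitrary \<open>M\<close> does not guarantee for
  \<open>norm (f x - s i x)\<close>.\<close>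

lemma bochner_has_integral_unique:
  fixes f :: "'b \<Rightarrow> 'a::banach"
  assumes "bochner_has_integral M f y" "bochner_has_integral M f z"
  shows "y = z"
proof -
  obtain s where s: "\<And>i. Bochner_Integration.simple_bochner_integrable M (s i)"
    "AE x in M. (\<lambda>i. s i x) \<longlonglongrightarrow> f x"
    "(\<lambda>i. \<integral>\<^sup>+x. ennreal (norm (f x - s i x)) \<partial>M) \<longlonglongrightarrow> 0"
    "(\<lambda>i. Bochner_Integration.simple_bochner_integral M (s i)) \<longlonglongrightarrow> y"
    using assms(1) by (auto simp: bochner_has_integral_def)
  obtain t where t: "\<And>i. Bochner_Integration.simple_bochner_integrable M (t i)"
    "(\<lambda>i. \<integral>\<^sup>+x. ennreal (norm (f x - t i x)) \<partial>M) \<longlonglongrightarrow> 0"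
    "(\<lambda>i. Bochner_Integration.simple_bochner_integral M (t i)) \<longlonglongrightarrow> z"
    using assms(2) by (auto simp: bochner_has_integral_def)
  have bound: "ennreal (norm (Bochner_Integration.simple_bochner_integral M (s i)
        - Bochner_Integration.simple_bochner_integral M (t i)))
      \<le> (\<integral>\<^sup>+x. ennreal (norm (f x - s i x)) \<partial>M) + (\<integral>\<^sup>+x. ennreal (norm (f x - t i x)) \<partial>M)" for i
  proof -
    note compose = Bochner_Integration.simple_bochner_integrable_compose2
    \<comment> \<open>A measurable version of \<open>norm (f x - v x)\<close>: a lower limit of
      measurable functions that agrees with it almost everywhere, because \<open>s j x\<close>
      converges to \<open>f x\<close>.\<close>
    define u where "u v x = liminf (\<lambda>j. ennreal (norm (s j x - v x)))" for v :: "'b \<Rightarrow> 'a" and x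
    have u: "AE x in M. ennreal (norm (f x - v x)) = u v x" for v
      using s(2)
    proof eventually_elim
      case (elim x)
      have "(\<lambda>j. ennreal (norm (s j x - v x))) \<longlonglongrightarrow> ennreal (norm (f x - v x))"
        by (intro tendsto_intros elim)
      then have "liminf (\<lambda>j. ennreal (norm (s j x - v x))) = ennreal (norm (f x - v x))"
        by (rule lim_imp_Liminf[OF sequentially_bot])
      then show ?case by (simp only: u_def)
    qed
    have meas: "u v \<in> borel_measurable M"
      if v: "Bochner_Integration.simple_bochner_integrable M v" for v
    proof -
      have "(\<lambda>x. ennreal (norm (s j x - v x))) \<in> borel_measurable M" for j
        using compose[of "\<lambda>a b. norm (a - b)", OF _ s(1) v, of j]
        by (auto elim!: Bochner_Integration.simple_bochner_integrable.cases
            dest!: borel_measurable_simple_function)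
      then show ?thesis unfolding u_def by measurable
    qed
    have "ennreal (norm (Bochner_Integration.simple_bochner_integral M (s i)
        - Bochner_Integration.simple_bochner_integral M (t i)))
      = ennreal (norm (Bochner_Integration.simple_bochner_integral M (\<lambda>x. s i x - t i x)))"
      by (simp add: Bochner_Integration.simple_bochner_integral_diff s t)
    also have "\<dots> \<le> ennreal (Bochner_Integration.simple_bochner_integral M (\<lambda>x. norm (s i x - t i x)))"
      by (intro ennreal_leI Bochner_Integration.simple_bochner_integral_norm_bound
          compose[of "(-)", OF _ s(1) t(1)]) simp
    also have "\<dots> = (\<integral>\<^sup>+x. norm (s i x - t i x) \<partial>M)"
      by (intro Bochner_Integration.simple_bochner_integral_eq_nn_integral
          compose[of "\<lambda>a b. norm (a - b)", OF _ s(1) t(1)]) simp_all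
    also have "\<dots> \<le> (\<integral>\<^sup>+x. u (s i) x + u (t i) x \<partial>M)"
    proof (rule nn_integral_mono_AE)
      show "AE x in M. ennreal (norm (s i x - t i x)) \<le> u (s i) x + u (t i) x"
        using u[of "s i"] u[of "t i"]
      proof eventually_elim
        case (elim x)
        have "norm (s i x - t i x) \<le> norm (f x - s i x) + norm (f x - t i x)"
          using norm_triangle_ineq4[of "f x - t i x" "f x - s i x"] by simp
        then have "ennreal (norm (s i x - t i x)) \<le> ennreal (norm (f x - s i x)) + ennreal (norm (f x - t i x))"
          by (simp flip: ennreal_plus)
        then show ?case
          by (simp only: elim)
      qed
    qed
    also have "\<dots> = integral\<^sup>N M (u (s i)) + integral\<^sup>N M (u (t i))"
      by (intro nn_integral_add meas s t)
    also have "integral\<^sup>N M (u (s i)) = (\<integral>\<^sup>+x. ennreal (norm (f x - s i x)) \<partial>M)"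
      using u[of "s i"] by (intro nn_integral_cong_AE) auto
    also have "integral\<^sup>N M (u (t i)) = (\<integral>\<^sup>+x. ennreal (norm (f x - t i x)) \<partial>M)"
      using u[of "t i"] by (intro nn_integral_cong_AE) auto
    finally show ?thesis .
  qed
  have "(\<lambda>i. ennreal (norm (Bochner_Integration.simple_bochner_integral M (s i)
        - Bochner_Integration.simple_bochner_integral M (t i)))) \<longlonglongrightarrow> 0"
  proof (rule tendsto_sandwich[OF _ _ tendsto_const])
    show "(\<lambda>i. (\<integral>\<^sup>+x. ennreal (norm (f x - s i x)) \<partial>M)
        + (\<integral>\<^sup>+x. ennreal (norm (f x - t i x)) \<partial>M)) \<longlonglongrightarrow> 0"
      using tendsto_add[OF s(3) t(2)] by simp
  qed (use bound in \<open>auto intro!: always_eventually\<close>)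
  moreover have "(\<lambda>i. ennreal (norm (Bochner_Integration.simple_bochner_integral M (s i)
        - Bochner_Integration.simple_bochner_integral M (t i)))) \<longlonglongrightarrow> ennreal (norm (y - z))"
    by (intro tendsto_intros s t)
  ultimately have "ennreal (norm (y - z)) = 0"
    using LIMSEQ_unique by blast
  then show ?thesis by (simp add: ennreal_eq_0_iff)
qed

lemma bochner_integral_eqI:
  "bochner_has_integral M f y \<Longrightarrow> bochner_integral M f = y"
  by (auto simp: bochner_integral_def bochner_integrable_def
      intro!: the_equality dest: bochner_has_integral_unique)

section \<open>Step functions and their gauge integrals\<close>

text \<open>On \<open>S\<close> the function is a finite sum of its values times indicators of its
  level sets, each of finite measure. This link makes the norm bounds and the fundamental theorem
  for the gauge integral available for Bochner integrals.\<close>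

lemma simple_bochner_has_integral:
  fixes s :: "'b::euclidean_space \<Rightarrow> 'a::banach"
  assumes s: "Bochner_Integration.simple_bochner_integrable (lebesgue_on S) s"
    and S: "S \<in> lmeasurable"
  shows "(s has_integral Bochner_Integration.simple_bochner_integral (lebesgue_on S) s) S"
proof -
  have fin: "finite (s ` S)"
    and sets: "\<And>y. {x \<in> S. s x = y} \<in> sets (lebesgue_on S)"
  proof -
    have sf: "simple_function (lebesgue_on S) s"
      using s by (rule Bochner_Integration.simple_bochner_integrable.cases)
    show "finite (s ` S)" using simple_functionD(1)[OF sf] by simp
    show "{x \<in> S. s x = y} \<in> sets (lebesgue_on S)" for y
      using simple_functionD(2)[OF sf, of "{y}"] by (simp add: vimage_def Int_def conj_commute)
  qed
  have "((\<lambda>x. indicator {x \<in> S. s x = y} x) has_integral measure (lebesgue_on S) {x \<in> S. s x = y}) S" for y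
  proof -
    have "{x \<in> S. s x = y} \<in> sets lebesgue"
      using sets[of y] S by (simp add: sets_restrict_space_iff fmeasurableD)
    then have "{x \<in> S. s x = y} \<in> lmeasurable"
      by (rule fmeasurableI2[OF S, rotated]) auto
    then have "(indicat_real {x \<in> S. s x = y} has_integral measure lebesgue {x \<in> S. s x = y}) UNIV"
      by (simp add: lmeasurable_iff_has_integral)
    then have "((\<lambda>x. if x \<in> S then indicat_real {x \<in> S. s x = y} x else 0)
        has_integral measure lebesgue {x \<in> S. s x = y}) UNIV"
      by (rule has_integral_eq[rotated]) (auto simp: indicator_def)
    then show ?thesis
      using S by (simp add: has_integral_restrict_UNIV measure_restrict_space fmeasurableD)
  qed
  then have "((\<lambda>x. \<Sum>y\<in>s ` S. indicator {x \<in> S. s x = y} x *\<^sub>R y) has_integral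
     Bochner_Integration.simple_bochner_integral (lebesgue_on S) s) S"
    unfolding Bochner_Integration.simple_bochner_integral_def
    by (auto intro!: has_integral_sum fin has_integral_scaleR_left)
  moreover have "(\<Sum>y\<in>s ` S. indicator {x \<in> S. s x = y} x *\<^sub>R y) = s x" if "x \<in> S" for x
  proof -
    have "(\<Sum>y\<in>s ` S. indicator {x \<in> S. s x = y} x *\<^sub>R y) = (\<Sum>y\<in>s ` S. if s x = y then y else 0)"
      using that by (intro sum.cong) (auto simp: indicator_def)
    then show ?thesis using that fin by (simp add: sum.delta)
  qed
  ultimately show ?thesis
    by (rule has_integral_eq[rotated])
qed

text \<open>By uniform continuity it suffices to sample \<open>g\<close> at the left ends of a fine
  enough grid on \<open>{a..c}\<close>. Stopping at \<open>c\<close> leaves room for a singularity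
  of \<open>g\<close> at \<open>b\<close>.\<close>

lemma step_approximation:
  fixes g :: "real \<Rightarrow> 'a::banach"
  assumes "continuous_on {a..c} g" "a \<le> c" "c \<le> b" "0 < e"
  obtains s where "Bochner_Integration.simple_bochner_integrable (lebesgue_on {a..b}) s"
    "\<And>x. x \<in> {a..c} \<Longrightarrow> norm (g x - s x) \<le> e" "\<And>x. x \<notin> {a..c} \<Longrightarrow> s x = 0"
proof -
  have "uniformly_continuous_on {a..c} g"
    using assms compact_uniformly_continuous by blast
  then obtain d where d: "d > 0"
    "\<And>x y. x \<in> {a..c} \<Longrightarrow> y \<in> {a..c} \<Longrightarrow> dist y x < d \<Longrightarrow> dist (g y) (g x) < e"
    using \<open>0 < e\<close> unfolding uniformly_continuous_on_def by metis
  define \<delta> where "\<delta> = d / 2"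
  have \<delta>: "\<delta> > 0" "\<delta> < d" using d(1) by (auto simp: \<delta>_def)
  \<comment> \<open>\<open>k\<close> is the grid index, with -1 marking points outside
    \<open>{a..c}\<close>. Since \<open>s\<close> factors through \<open>k\<close>, which is Borel
    and has finite range on \<open>{a..b}\<close>, it is a simple function.\<close>
  define k :: "real \<Rightarrow> real" where
    "k x = (if a \<le> x \<and> x \<le> c then of_int \<lfloor>(x - a) / \<delta>\<rfloor> else -1)" for x
  define s where "s x = (if k x < 0 then 0 else g (a + \<delta> * k x))" for x
  have k_nonneg: "0 \<le> k x" if "x \<in> {a..c}" for x
    using that \<delta> by (auto simp: k_def)
  have k_neg: "k x = -1" if "x \<notin> {a..c}" for x
    using that by (auto simp: k_def)
  have "k ` {a..b} \<subseteq> of_int ` {-1..\<lfloor>(c - a) / \<delta>\<rfloor>}"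
  proof
    fix y assume "y \<in> k ` {a..b}"
    then obtain x where x: "x \<in> {a..b}" "y = k x" by auto
    show "y \<in> of_int ` {-1..\<lfloor>(c - a) / \<delta>\<rfloor>}"
    proof (cases "x \<in> {a..c}")
      case True
      then have "k x = of_int \<lfloor>(x - a) / \<delta>\<rfloor>" by (simp add: k_def)
      moreover have "\<lfloor>(x - a) / \<delta>\<rfloor> \<le> \<lfloor>(c - a) / \<delta>\<rfloor>"
        using True \<delta> by (intro floor_mono divide_right_mono) auto
      moreover have "0 \<le> \<lfloor>(x - a) / \<delta>\<rfloor>"
        using True \<delta> by auto
      ultimately have "-1 \<le> \<lfloor>(x - a) / \<delta>\<rfloor>" "k x = of_int \<lfloor>(x - a) / \<delta>\<rfloor>" "\<lfloor>(x - a) / \<delta>\<rfloor> \<le> \<lfloor>(c - a) / \<delta>\<rfloor>" by linarith+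
      then show ?thesis using x by (intro image_eqI[where x="\<lfloor>(x - a) / \<delta>\<rfloor>"]) auto
    next
      case False
      moreover have "0 \<le> \<lfloor>(c - a) / \<delta>\<rfloor>" using \<delta> \<open>a \<le> c\<close> by auto
      then have "-1 \<le> \<lfloor>(c - a) / \<delta>\<rfloor>" by linarith
      ultimately show ?thesis using x
        by (auto simp: k_neg intro!: image_eqI[where x="-1"])
    qed
  qed
  then have fin: "finite (k ` {a..b})"
    by (rule finite_subset) simp
  have "k \<in> borel_measurable borel"
    unfolding k_def[abs_def] by measurable
  then have "k \<in> borel_measurable (lebesgue_on {a..b})"
    by (simp add: measurable_completion measurable_restrict_space1)
  then have "simple_function (lebesgue_on {a..b}) k"
    using fin by (auto intro: simple_function_borel_measurable)
  then have "simple_function (lebesgue_on {a..b}) (\<lambda>x. (\<lambda>r. if r < 0 then 0 else g (a + \<delta> * r)) (k x))"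
    by (rule simple_function_compose1)
  then have "simple_function (lebesgue_on {a..b}) s"
    by (simp add: s_def[abs_def])
  moreover have "emeasure (lebesgue_on {a..b}) {y \<in> space (lebesgue_on {a..b}). s y \<noteq> 0} \<noteq> \<infinity>"
  proof -
    have "emeasure (lebesgue_on {a..b}) {y \<in> space (lebesgue_on {a..b}). s y \<noteq> 0}
        \<le> emeasure (lebesgue_on {a..b}) (space (lebesgue_on {a..b}))"
      by (rule emeasure_space)
    also have "\<dots> < \<infinity>"
      by (simp add: space_restrict_space emeasure_restrict_space emeasure_lborel_Icc_eq)
    finally show ?thesis by simp
  qed
  ultimately have "Bochner_Integration.simple_bochner_integrable (lebesgue_on {a..b}) s"
    by (intro Bochner_Integration.simple_bochner_integrable.intros)
  moreover have "norm (g x - s x) \<le> e" if x: "x \<in> {a..c}" for x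
  proof -
    have kx: "k x = of_int \<lfloor>(x - a) / \<delta>\<rfloor>" using x by (auto simp: k_def)
    have "\<delta> * k x \<le> x - a" "x - a < \<delta> * k x + \<delta>"
    proof -
      have "k x \<le> (x - a) / \<delta>" "(x - a) / \<delta> < k x + 1"
        unfolding kx by linarith+
      then show "\<delta> * k x \<le> x - a" "x - a < \<delta> * k x + \<delta>"
        using \<delta> by (simp_all add: field_simps)
    qed
    moreover have "0 \<le> \<delta> * k x" using k_nonneg[OF x] \<delta> by simp
    ultimately have "dist (g (a + \<delta> * k x)) (g x) < e"
      using x \<delta> by (intro d) (auto simp: dist_real_def)
    then show ?thesis
      using k_nonneg[OF x] by (simp add: s_def dist_norm norm_minus_commute)
  qed
  moreover have "s x = 0" if "x \<notin> {a..c}" for x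
    using k_neg[OF that] by (simp add: s_def)
  ultimately show ?thesis using that by blast
qed

section \<open>Integrals with an endpoint singularity\<close>

lemma has_integral_reflect_shift:
  fixes f :: "real \<Rightarrow> 'a::banach"
  assumes "(f has_integral I) {a..b}"
  shows "((\<lambda>x. f (t - x)) has_integral I) {t - b..t - a}"
proof -
  have "((\<lambda>x. f (- x)) has_integral I) {-b..-a}"
    using assms by simp
  from has_integral_shift_real_ivl[OF this, of "- t"] show ?thesis
    by (simp add: algebra_simps)
qed

lemma has_integral_powr_singular:
  fixes p :: real
  assumes "0 < p" "c \<le> b"
  shows "((\<lambda>x. (b - x) powr (p - 1)) has_integral (b - c) powr p / p) {c..b}"
  using has_integral_reflect_shift[OF has_integral_powr_from_0[of "p - 1" "b - c"], of b] assms
  by simp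

lemma AE_lebesgue_on_neq:
  fixes a b c :: real
  shows "AE x in lebesgue_on {a..b}. x \<noteq> c"
proof -
  have "AE x in lebesgue. x \<noteq> c"
    by (intro AE_completion AE_lborel_singleton)
  then show ?thesis
    by (subst AE_restrict_space_iff) auto
qed

text \<open>The majorant is integrable up to \<open>b\<close> because \<open>p > 0\<close>, and its
  integral over \<open>{c..b}\<close> is the stated error. Hence the gauge integrals over
  \<open>{a..c}\<close> are Cauchy as \<open>c\<close> tends to \<open>b\<close>, and their limit is
  the Bochner integral. Applied with \<open>p\<close> equal to \<open>1 - \<alpha>\<close> for the
  fractional integral, \<open>\<beta> - \<alpha>\<close> for the Marchaud integral and 1 for
  continuous integrands.\<close>

lemma bochner_has_integral_singular:
  fixes g :: "real \<Rightarrow> 'a::banach"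
  assumes ab: "a < b" and p: "0 < p" and cont: "continuous_on {a..<b} g"
    and bound: "\<And>x. x \<in> {a..<b} \<Longrightarrow> norm (g x) \<le> C * (b - x) powr (p - 1)"
  obtains y where "bochner_has_integral (lebesgue_on {a..b}) g y"
    "\<And>c. c \<in> {a..<b} \<Longrightarrow> norm (y - integral {a..c} g) \<le> C * ((b - c) powr p / p)"
proof -
  have "0 \<le> C * (b - a) powr (p - 1)"
    using order_trans[OF norm_ge_zero bound[of a]] ab by simp
  then have C: "0 \<le> C"
    using ab by (simp add: zero_le_mult_iff)
  have integrable: "g integrable_on {c..d}" if "a \<le> c" "d < b" for c d
    using that by (intro integrable_continuous_real continuous_on_subset[OF cont]) auto
  have tail: "((\<lambda>x. C * (b - x) powr (p - 1)) has_integral C * ((b - c) powr p / p)) {c..b}" if "c \<le> b" for c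
    by (rule has_integral_mult_right[OF has_integral_powr_singular[OF p that]])
  \<comment> \<open>Bounding by the whole tail up to \<open>b\<close> makes the estimate independent
    of \<open>d\<close>.\<close>
  have step: "norm (integral {a..d} g - integral {a..c} g) \<le> C * ((b - c) powr p / p)"
    if "a \<le> c" "c \<le> d" "d < b" for c d
  proof -
    have sub: "(\<lambda>x. C * (b - x) powr (p - 1)) integrable_on {c..d}"
      using that by (intro integrable_on_subinterval[OF has_integral_integrable[OF tail]]) auto
    have "integral {a..d} g - integral {a..c} g = integral {c..d} g"
      using Henstock_Kurzweil_Integration.integral_combine[OF that(1,2) integrable] that
      by (simp add: algebra_simps)
    also have "norm \<dots> \<le> integral {c..d} (\<lambda>x. C * (b - x) powr (p - 1))"
      using that by (intro integral_norm_bound_integral integrable bound sub) auto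
    also have "\<dots> \<le> integral {c..b} (\<lambda>x. C * (b - x) powr (p - 1))"
      using that C sub has_integral_integrable[OF tail[of c]] by (intro integral_subset_le) simp_all
    also have "\<dots> = C * ((b - c) powr p / p)"
      using that by (intro integral_unique tail) simp
    finally show ?thesis .
  qed
  \<comment> \<open>\<open>e n\<close> plays two roles: the accuracy of the \<open>n\<close>-th step
    function and the relative distance of the cut \<open>c n\<close> from \<open>b\<close>. As
    \<open>e 0 = 1\<close>, the cuts start at \<open>a\<close>.\<close>
  define e :: "nat \<Rightarrow> real" where "e n = inverse (real (Suc n))" for n
  have e: "0 < e n" "e n \<le> 1" "e \<longlonglongrightarrow> 0" for n
    using LIMSEQ_inverse_real_of_nat by (auto simp: e_def[abs_def] field_simps)
  define c where "c n = b - (b - a) * e n" for n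
  have c: "c n \<in> {a..<b}" "c \<longlonglongrightarrow> b" for n
  proof -
    have "(b - a) * e n \<le> (b - a) * 1"
      using e ab by (intro mult_left_mono) auto
    moreover have "0 < (b - a) * e n" using e ab by simp
    ultimately show "c n \<in> {a..<b}" by (auto simp: c_def)
    have "(\<lambda>n. b - (b - a) * e n) \<longlonglongrightarrow> b - (b - a) * 0"
      by (intro tendsto_intros e)
    then show "c \<longlonglongrightarrow> b" by (simp add: c_def[abs_def])
  qed
  have c_mono: "c m \<le> c n" if "m \<le> n" for m n
    using that ab by (auto simp: c_def e_def intro!: mult_left_mono le_imp_inverse_le)
  define r where "r n = C * ((b - c n) powr p / p)" for n
  have r: "r \<longlonglongrightarrow> 0"
  proof -
    have "(\<lambda>n. (b - c n) powr p) \<longlonglongrightarrow> 0 powr p"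
      using tendsto_diff[OF tendsto_const c(2), of b] p
      by (intro tendsto_powr') (auto intro!: always_eventually less_imp_le simp: c(1)[simplified])
    then have "(\<lambda>n. C * ((b - c n) powr p / p)) \<longlonglongrightarrow> C * (0 / p)"
      using p by (intro tendsto_intros) auto
    then show ?thesis by (simp add: r_def[abs_def])
  qed
  define I where "I n = integral {a..c n} g" for n
  have I_step: "norm (I n - I m) \<le> r m" if "m \<le> n" for m n
    unfolding I_def r_def using c c_mono[OF that] by (intro step) auto
  have "Cauchy I"
  proof (rule CauchyI)
    fix \<epsilon> :: real assume "0 < \<epsilon>"
    then obtain N where N: "r N < \<epsilon> / 2"
      using r order_tendstoD(2)[of r 0 sequentially "\<epsilon> / 2"] by (auto simp: eventually_sequentially)
    have "norm (I m - I n) < \<epsilon>" if "N \<le> m" "N \<le> n" for m n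
      using I_step[OF that(1)] I_step[OF that(2)] N norm_triangle_ineq4[of "I m - I N" "I n - I N"]
      by simp
    then show "\<exists>N. \<forall>m\<ge>N. \<forall>n\<ge>N. norm (I m - I n) < \<epsilon>" by blast
  qed
  then obtain y where y: "I \<longlonglongrightarrow> y"
    by (auto simp: Cauchy_convergent_iff convergent_def)
  \<comment> \<open>The estimate \<open>step\<close> with its right end at \<open>c n\<close>, in
    the limit of large \<open>n\<close>.\<close>
  have y_bound: "norm (y - integral {a..d} g) \<le> C * ((b - d) powr p / p)" if d: "d \<in> {a..<b}" for d
  proof (rule tendsto_upperbound)
    show "(\<lambda>n. norm (I n - integral {a..d} g)) \<longlonglongrightarrow> norm (y - integral {a..d} g)"
      by (intro tendsto_intros y)
    have "eventually (\<lambda>n. d < c n) sequentially"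
      using d c(2) by (intro order_tendstoD(1)) auto
    then show "\<forall>\<^sub>F n in sequentially. norm (I n - integral {a..d} g) \<le> C * ((b - d) powr p / p)"
    proof eventually_elim
      case (elim n)
      then show ?case
        unfolding I_def using d c(1)[of n] by (intro step) auto
    qed
  qed simp
  \<comment> \<open>The approximating simple functions follow \<open>g\<close> up to
    \<open>e n\<close> on \<open>{a..c n}\<close> and ignore the singular end.\<close>
  have "\<exists>s. Bochner_Integration.simple_bochner_integrable (lebesgue_on {a..b}) s \<and>
      (\<forall>x\<in>{a..c n}. norm (g x - s x) \<le> e n) \<and> (\<forall>x. x \<notin> {a..c n} \<longrightarrow> s x = 0)" for n
  proof -
    have "continuous_on {a..c n} g"
      using c(1)[of n] by (intro continuous_on_subset[OF cont]) auto
    then show ?thesis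
      using c(1)[of n] e(1)[of n] step_approximation[of a "c n" g b "e n"]
      by (metis atLeastLessThan_iff less_imp_le)
  qed
  then obtain s where s: "\<And>n. Bochner_Integration.simple_bochner_integrable (lebesgue_on {a..b}) (s n)"
    "\<And>n x. x \<in> {a..c n} \<Longrightarrow> norm (g x - s n x) \<le> e n"
    "\<And>n x. x \<notin> {a..c n} \<Longrightarrow> s n x = 0"
    by metis
  have "bochner_has_integral (lebesgue_on {a..b}) g y"
    unfolding bochner_has_integral_def
  proof (intro exI[of _ s] conjI allI)
    show "AE x in lebesgue_on {a..b}. (\<lambda>i. s i x) \<longlonglongrightarrow> g x"
      using AE_lebesgue_on_neq[of b a b] AE_space
    proof eventually_elim
      case (elim x)
      have "eventually (\<lambda>n. x < c n) sequentially"
        using elim c(2) by (intro order_tendstoD(1)) auto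
      then have "eventually (\<lambda>n. norm (s n x - g x) \<le> e n) sequentially"
        by eventually_elim (use elim s(2) in \<open>auto simp: norm_minus_commute\<close>)
      then have "(\<lambda>n. s n x - g x) \<longlonglongrightarrow> 0"
        using e(3) by (rule Lim_null_comparison)
      then show ?case by (simp add: LIM_zero_iff)
    qed
    show "(\<lambda>i. Bochner_Integration.simple_bochner_integral (lebesgue_on {a..b}) (s i)) \<longlonglongrightarrow> y"
    proof -
      define S where "S n = Bochner_Integration.simple_bochner_integral (lebesgue_on {a..b}) (s n)" for n
      \<comment> \<open>Beyond \<open>c n\<close> both integrands are 0, so only the accuracy
        \<open>e n\<close> on an interval of length at most \<open>b - a\<close> enters.\<close>
      have "norm (S n - I n) \<le> e n * (b - a)" for n
      proof -
        have "(s n has_integral S n) {a..b}"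
          unfolding S_def by (rule simple_bochner_has_integral[OF s(1)]) simp
        moreover have "((\<lambda>x. if x \<in> {a..c n} then g x else 0) has_integral I n) {a..b}"
          using c(1)[of n] unfolding I_def
          by (subst has_integral_restrict) (auto intro!: integrable_integral integrable)
        ultimately have "((\<lambda>x. s n x - (if x \<in> {a..c n} then g x else 0)) has_integral S n - I n) {a..b}"
          by (rule has_integral_diff)
        then have "norm (S n - I n) \<le> e n * Henstock_Kurzweil_Integration.content {a..b}"
          using e(1)[of n] s(2,3)[of _ n]
          by (intro has_integral_bound_real[where S="{}"])
            (auto simp: norm_minus_commute intro: less_imp_le)
        then show ?thesis using ab by simp
      qed
      moreover have "(\<lambda>n. e n * (b - a)) \<longlonglongrightarrow> 0 * (b - a)"
        by (intro tendsto_intros e)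
      ultimately have "(\<lambda>n. S n - I n) \<longlonglongrightarrow> 0"
        by (intro Lim_null_comparison[of "\<lambda>n. S n - I n" "\<lambda>n. e n * (b - a)"]) auto
      from tendsto_add[OF this y] show ?thesis
        by (simp add: S_def)
    qed
    show "(\<lambda>i. \<integral>\<^sup>+x. ennreal (norm (g x - s i x)) \<partial>lebesgue_on {a..b}) \<longlonglongrightarrow> 0"
    proof (rule tendsto_sandwich[OF _ _ tendsto_const])
      \<comment> \<open>A measurable majorant of the error: the accuracy \<open>e n\<close>
        everywhere, and the singular bound where \<open>s n\<close> is 0. Its integral is
        \<open>e n * (b - a) + r n\<close>. The point \<open>b\<close>, where \<open>g\<close> is
        uncontrolled, is excluded as a null set.\<close>
      define h where "h n x = e n + (if x \<in> {c n..b} then C * (b - x) powr (p - 1) else 0)" for n x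
      have "(\<integral>\<^sup>+x. ennreal (norm (g x - s n x)) \<partial>lebesgue_on {a..b}) \<le> ennreal (e n * (b - a) + r n)" for n
      proof -
        have "(\<integral>\<^sup>+x. ennreal (norm (g x - s n x)) \<partial>lebesgue_on {a..b})
            \<le> (\<integral>\<^sup>+x. ennreal (h n x) \<partial>lebesgue_on {a..b})"
        proof (rule nn_integral_mono_AE)
          show "AE x in lebesgue_on {a..b}. ennreal (norm (g x - s n x)) \<le> ennreal (h n x)"
            using AE_lebesgue_on_neq[of b a b] AE_space
          proof eventually_elim
            case (elim x)
            show ?case
            proof (cases "x \<in> {a..c n}")
              case True
              then show ?thesis
                using s(2)[OF True] C by (intro ennreal_leI) (auto simp: h_def intro!: add_increasing2)
            next
              case False
              then show ?thesis
                using s(3)[OF False] elim bound[of x] e(1)[of n]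
                by (intro ennreal_leI) (auto simp: h_def)
            qed
          qed
        qed
        also have "\<dots> = (\<integral>\<^sup>+x. ennreal (h n x) * indicator {a..b} x \<partial>lborel)"
          by (simp add: nn_integral_restrict_space nn_integral_completion)
        also have "\<dots> = ennreal (e n * (b - a) + r n)"
        proof (rule nn_integral_has_integral_lebesgue')
          show "0 \<le> h n x" for x
            using C e(1)[of n] by (simp add: h_def)
          have "((\<lambda>x. if x \<in> {c n..b} then C * (b - x) powr (p - 1) else 0) has_integral r n) {a..b}"
            using c(1)[of n] tail[of "c n"] by (subst has_integral_restrict) (auto simp: r_def)
          moreover have "((\<lambda>x. e n) has_integral e n * (b - a)) {a..b}"
            using has_integral_const_real[of "e n" a b] ab by (simp add: mult.commute)
          ultimately show "(h n has_integral e n * (b - a) + r n) {a..b}"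
            unfolding h_def by (intro has_integral_add)
        qed
        finally show ?thesis .
      qed
      then show "\<forall>\<^sub>F n in sequentially. (\<integral>\<^sup>+x. ennreal (norm (g x - s n x)) \<partial>lebesgue_on {a..b})
          \<le> ennreal (e n * (b - a) + r n)"
        by auto
      have "(\<lambda>n. ennreal (e n * (b - a) + r n)) \<longlonglongrightarrow> ennreal (0 * (b - a) + 0)"
        by (intro tendsto_intros e r)
      then show "(\<lambda>n. ennreal (e n * (b - a) + r n)) \<longlonglongrightarrow> 0" by simp
    qed auto
  qed (rule s)
  then show ?thesis using y_bound that by blast
qed

text \<open>The domain is a null set, so the zero sequence approximates every function. This covers
  the endpoint \<open>t = t0\<close>.\<close>

lemma bochner_has_integral_singleton:
  fixes g :: "real \<Rightarrow> 'a::banach"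
  shows "bochner_has_integral (lebesgue_on {a..a}) g 0"
  unfolding bochner_has_integral_def
proof (intro exI[of _ "\<lambda>_ _. 0"] conjI allI)
  have null: "AE x in lebesgue_on {a..a}. False"
    using AE_lebesgue_on_neq[of a a a] AE_space by eventually_elim auto
  then show "AE x in lebesgue_on {a..a}. (\<lambda>i. 0) \<longlonglongrightarrow> g x"
    by eventually_elim auto
  have "(\<integral>\<^sup>+x. ennreal (norm (g x - 0)) \<partial>lebesgue_on {a..a}) = (\<integral>\<^sup>+x. 0 \<partial>lebesgue_on {a..a})"
    using null by (intro nn_integral_cong_AE) auto
  then show "(\<lambda>i. \<integral>\<^sup>+x. ennreal (norm (g x - 0)) \<partial>lebesgue_on {a..a}) \<longlonglongrightarrow> 0"
    by simp
qed (auto intro!: Bochner_Integration.simple_bochner_integrable.intros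
    simp: Bochner_Integration.simple_bochner_integral_def)

text \<open>The case \<open>p = 1\<close> of the singular lemma. Its value and the gauge integral
  are both the left limit at \<open>b\<close> of the integrals over \<open>{a..c}\<close>.\<close>

lemma bochner_has_integral_continuous:
  fixes g :: "real \<Rightarrow> 'a::banach"
  assumes ab: "a < b" and cont: "continuous_on {a..b} g"
  shows "bochner_has_integral (lebesgue_on {a..b}) g (integral {a..b} g)"
proof -
  obtain C where C: "\<And>x. x \<in> {a..b} \<Longrightarrow> norm (g x) \<le> C"
    using compact_imp_bounded[OF compact_continuous_image[OF cont compact_Icc]]
    unfolding bounded_iff by blast
  have "continuous_on {a..<b} g"
    by (rule continuous_on_subset[OF cont]) auto
  then obtain y where y: "bochner_has_integral (lebesgue_on {a..b}) g y"
    "\<And>c. c \<in> {a..<b} \<Longrightarrow> norm (y - integral {a..c} g) \<le> C * ((b - c) powr 1 / 1)"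
    by (rule bochner_has_integral_singular[OF ab zero_less_one, of g C])
      (use C in \<open>simp_all del: div_by_1\<close>)
  have "((\<lambda>c. integral {a..c} g) \<longlongrightarrow> integral {a..b} g) (at b within {a..b})"
    using indefinite_integral_continuous_1[OF integrable_continuous_real[OF cont]] ab
    by (auto simp: continuous_on_def)
  then have "((\<lambda>c. integral {a..c} g) \<longlongrightarrow> integral {a..b} g) (at_left b)"
    using ab by (simp add: at_within_Icc_at_left)
  moreover have "((\<lambda>c. y - integral {a..c} g) \<longlongrightarrow> 0) (at_left b)"
  proof (rule Lim_null_comparison)
    show "\<forall>\<^sub>F c in at_left b. norm (y - integral {a..c} g) \<le> C * (b - c)"
      using eventually_at_left_real[OF ab] by eventually_elim (use y(2) in force)
    have "((\<lambda>c. C * (b - c)) \<longlongrightarrow> C * (b - b)) (at_left b)"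
      by (intro tendsto_intros)
    then show "((\<lambda>c. C * (b - c)) \<longlongrightarrow> 0) (at_left b)" by simp
  qed
  then have "((\<lambda>c. integral {a..c} g) \<longlongrightarrow> y) (at_left b)"
    using tendsto_diff[OF tendsto_const[of y]] by fastforce
  ultimately have "y = integral {a..b} g"
    using tendsto_unique trivial_limit_at_left_real by blast
  then show ?thesis using y by simp
qed

lemma bochner_has_integral_cong:
  assumes "\<And>x. x \<in> space M \<Longrightarrow> f x = g x"
  shows "bochner_has_integral M f y \<longleftrightarrow> bochner_has_integral M g y"
proof -
  have "(AE x in M. (\<lambda>i. s i x) \<longlonglongrightarrow> f x) \<longleftrightarrow> (AE x in M. (\<lambda>i. s i x) \<longlonglongrightarrow> g x)" for s
    using assms by (intro AE_cong) simp
  moreover have "(\<integral>\<^sup>+x. ennreal (norm (f x - s x)) \<partial>M) = (\<integral>\<^sup>+x. ennreal (norm (g x - s x)) \<partial>M)" for s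
    using assms by (intro nn_integral_cong) simp
  ultimately show ?thesis by (simp add: bochner_has_integral_def)
qed

lemma bochner_integral_cong:
  assumes "\<And>x. x \<in> space M \<Longrightarrow> f x = g x"
  shows "bochner_integrable M f \<longleftrightarrow> bochner_integrable M g"
    and "bochner_integral M f = bochner_integral M g"
proof -
  have "bochner_has_integral M f = bochner_has_integral M g"
    by (intro ext bochner_has_integral_cong assms)
  then show "bochner_integrable M f \<longleftrightarrow> bochner_integrable M g"
    and "bochner_integral M f = bochner_integral M g"
    by (simp_all add: bochner_integral_def bochner_integrable_def)
qed

section \<open>Truncated fractional integrals\<close>

definition truncated_RL :: "real \<Rightarrow> real \<Rightarrow> real \<Rightarrow> (real \<Rightarrow> 'a::banach) \<Rightarrow> real \<Rightarrow> 'a" where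
  "truncated_RL \<alpha> L e h t = integral {e..L} (\<lambda>u. u powr (-\<alpha>) *\<^sub>R h (t - u))"

text \<open>The derivative of \<open>truncated_RL\<close> in \<open>t\<close>, in the form it takes
  after a formal integration by parts. Only the boundary term at \<open>u = e\<close> appears: the
  one at \<open>u = L\<close> carries \<open>h (t - L)\<close>, which is 0 for
  \<open>t \<le> t0 + L\<close>.\<close>

definition truncated_Marchaud :: "real \<Rightarrow> real \<Rightarrow> real \<Rightarrow> (real \<Rightarrow> 'a::banach) \<Rightarrow> real \<Rightarrow> 'a" where
  "truncated_Marchaud \<alpha> L e h t =
     e powr (-\<alpha>) *\<^sub>R h (t - e) - \<alpha> *\<^sub>R integral {e..L} (\<lambda>u. u powr (-\<alpha> - 1) *\<^sub>R h (t - u))"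

lemma integral_delayed_eq_0:
  fixes h :: "real \<Rightarrow> 'a::banach"
  assumes "\<And>s. s \<le> t0 \<Longrightarrow> h s = 0" "t - t0 \<le> e"
  shows "integral {e..L} (\<lambda>u. k u *\<^sub>R h (t - u)) = 0"
proof -
  have "integral {e..L} (\<lambda>u. k u *\<^sub>R h (t - u)) = integral {e..L} (\<lambda>u. 0)"
    using assms by (intro integral_cong) simp
  then show ?thesis by simp
qed

text \<open>For \<open>u > t - t0\<close> the integrand vanishes, and on the remaining range
  \<open>s = t - u\<close> is substituted. This translates the window \<open>{e..L}\<close>, common
  to all \<open>t\<close>, back to the domain of the original integrals.\<close>

lemma integral_delayed:
  fixes h :: "real \<Rightarrow> 'a::banach" and k :: "real \<Rightarrow> real"
  assumes h: "continuous_on UNIV h" "\<And>s. s \<le> t0 \<Longrightarrow> h s = 0"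
    and k: "continuous_on {e..L} k" and t: "e \<le> t - t0" "t - t0 \<le> L"
  shows "integral {e..L} (\<lambda>u. k u *\<^sub>R h (t - u)) = integral {t0..t - e} (\<lambda>s. k (t - s) *\<^sub>R h s)"
proof -
  have cont: "continuous_on {e..L} (\<lambda>u. k u *\<^sub>R h (t - u))"
    by (intro continuous_intros k continuous_on_compose2[OF h(1)]) auto
  have "integral {e..L} (\<lambda>u. k u *\<^sub>R h (t - u))
      = integral {e..t - t0} (\<lambda>u. k u *\<^sub>R h (t - u)) + integral {t - t0..L} (\<lambda>u. k u *\<^sub>R h (t - u))"
    using t by (simp add: Henstock_Kurzweil_Integration.integral_combine
        integrable_continuous_real[OF cont])
  also have "integral {t - t0..L} (\<lambda>u. k u *\<^sub>R h (t - u)) = 0"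
    by (rule integral_delayed_eq_0[OF h(2)]) auto
  also have "integral {e..t - t0} (\<lambda>u. k u *\<^sub>R h (t - u)) = integral {t0..t - e} (\<lambda>s. k (t - s) *\<^sub>R h s)"
  proof -
    have "(\<lambda>u. k u *\<^sub>R h (t - u)) integrable_on {e..t - t0}"
      using t by (intro integrable_continuous_real continuous_on_subset[OF cont]) auto
    from integral_unique[OF has_integral_reflect_shift[OF integrable_integral[OF this], of t]]
    show ?thesis by simp
  qed
  finally show ?thesis by simp
qed

text \<open>
  Integrating by parts against the primitive \<open>\<Phi>\<close> of \<open>h\<close> moves the difference quotient in \<open>t\<close> from \<open>h\<close>,
  which need not be differentiable, to \<open>\<Phi>\<close>.
\<close>

lemma truncated_RL_has_vector_derivative:
  fixes h :: "real \<Rightarrow> 'a::banach"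
  assumes h: "continuous_on UNIV h" "\<And>s. s \<le> t0 \<Longrightarrow> h s = 0"
    and e: "0 < e" "e < L" and t: "t \<in> {t0..t0 + L}"
  shows "(truncated_RL \<alpha> L e h has_vector_derivative truncated_Marchaud \<alpha> L e h t) (at t within {t0..t0 + L})"
proof -
  \<comment> \<open>The arguments \<open>x - u\<close> lie in \<open>{t0 - L..t0 + L}\<close>.
    Starting the primitive one unit further left makes them interior points, so that \<Phi> has
    two-sided derivatives there.\<close>
  define \<Phi> where "\<Phi> x = integral {t0 - L - 1..x} h" for x
  have \<Phi>_deriv: "(\<Phi> has_vector_derivative h x) (at x)" if "x \<in> {t0 - L..t0 + L}" for x
  proof -
    have "(\<Phi> has_vector_derivative h x) (at x within {t0 - L - 1..t0 + L + 1})"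
      unfolding \<Phi>_def using that
      by (intro integral_has_vector_derivative continuous_on_subset[OF h(1)]) auto
    moreover have "at x within {t0 - L - 1..t0 + L + 1} = at x"
      using that by (intro at_within_Icc_at) auto
    ultimately show ?thesis by simp
  qed
  have \<Phi>_0: "\<Phi> x = 0" if "x \<le> t0" for x
  proof -
    have "\<Phi> x = integral {t0 - L - 1..x} (\<lambda>_. 0)"
      unfolding \<Phi>_def using that h(2) by (intro integral_cong) auto
    then show ?thesis by simp
  qed
  have \<Phi>_cont: "continuous_on {t0 - L..t0 + L} \<Phi>"
    by (rule continuous_on_vector_derivative[OF has_vector_derivative_at_within[OF \<Phi>_deriv]])
  have \<Phi>_t: "((\<lambda>t. \<Phi> (t - u)) has_vector_derivative h (x - u)) (at x within S)"
    if "x \<in> {t0..t0 + L}" "u \<in> {e..L}" for x u S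
  proof -
    have "(\<Phi> \<circ> (\<lambda>t. t - u) has_vector_derivative 1 *\<^sub>R h (x - u)) (at x)"
      using that e by (intro vector_diff_chain_at \<Phi>_deriv) (auto intro!: derivative_eq_intros)
    then show ?thesis by (simp add: o_def has_vector_derivative_at_within)
  qed
  have \<Phi>_u: "((\<lambda>u. \<Phi> (x - u)) has_vector_derivative - h (x - u)) (at u within S)"
    if "x \<in> {t0..t0 + L}" "u \<in> {e..L}" for x u S
  proof -
    have "(\<Phi> \<circ> (\<lambda>u. x - u) has_vector_derivative (-1) *\<^sub>R h (x - u)) (at u)"
      using that e by (intro vector_diff_chain_at \<Phi>_deriv) (auto intro!: derivative_eq_intros)
    then show ?thesis by (simp add: o_def has_vector_derivative_at_within)
  qed
  have cont2: "continuous_on ({t0..t0 + L} \<times> {e..L}) (\<lambda>(x, u). u powr (-\<alpha> - 1) *\<^sub>R g (x - u))"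
    if "continuous_on {t0 - L..t0 + L} g" for g :: "real \<Rightarrow> 'a"
    unfolding case_prod_beta using e
    by (intro continuous_intros continuous_on_compose2[OF that]) auto
  have integrable: "(\<lambda>u. u powr (-\<alpha> - 1) *\<^sub>R \<Phi> (x - u)) integrable_on {e..L}"
    if "x \<in> {t0..t0 + L}" for x
    using that e
    by (intro integrable_continuous_real continuous_intros continuous_on_compose2[OF \<Phi>_cont]) auto
  \<comment> \<open>Integration by parts. The boundary term at \<open>u = L\<close> disappears
    because \<open>x - L \<le> t0\<close>, where \<Phi> is 0.\<close>
  have parts: "truncated_RL \<alpha> L e h x =
      e powr (-\<alpha>) *\<^sub>R \<Phi> (x - e) - \<alpha> *\<^sub>R integral {e..L} (\<lambda>u. u powr (-\<alpha> - 1) *\<^sub>R \<Phi> (x - u))"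
    if x: "x \<in> {t0..t0 + L}" for x
  proof -
    have "((\<lambda>u. u powr (-\<alpha>) *\<^sub>R \<Phi> (x - u)) has_vector_derivative
        u powr (-\<alpha>) *\<^sub>R - h (x - u) + (-\<alpha> * u powr (-\<alpha> - 1)) *\<^sub>R \<Phi> (x - u)) (at u within {e..L})"
      if "u \<in> {e..L}" for u
      using that e
      by (intro has_vector_derivative_scaleR \<Phi>_u[OF x]
          has_field_derivative_at_within[OF has_real_derivative_powr]) auto
    then have "((\<lambda>u. u powr (-\<alpha>) *\<^sub>R - h (x - u) + (-\<alpha> * u powr (-\<alpha> - 1)) *\<^sub>R \<Phi> (x - u)) has_integral
        L powr (-\<alpha>) *\<^sub>R \<Phi> (x - L) - e powr (-\<alpha>) *\<^sub>R \<Phi> (x - e)) {e..L}"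
      using e by (intro fundamental_theorem_of_calculus) auto
    moreover have "((\<lambda>u. \<alpha> *\<^sub>R (u powr (-\<alpha> - 1) *\<^sub>R \<Phi> (x - u))) has_integral
        \<alpha> *\<^sub>R integral {e..L} (\<lambda>u. u powr (-\<alpha> - 1) *\<^sub>R \<Phi> (x - u))) {e..L}"
      by (intro has_integral_cmul integrable_integral integrable x)
    ultimately have "((\<lambda>u. - (u powr (-\<alpha>) *\<^sub>R h (x - u))) has_integral
        (L powr (-\<alpha>) *\<^sub>R \<Phi> (x - L) - e powr (-\<alpha>) *\<^sub>R \<Phi> (x - e)) +
         \<alpha> *\<^sub>R integral {e..L} (\<lambda>u. u powr (-\<alpha> - 1) *\<^sub>R \<Phi> (x - u))) {e..L}"
      by (rule has_integral_eq[rotated, OF has_integral_add]) simp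
    from integral_unique[OF has_integral_neg[OF this]] show ?thesis
      using \<Phi>_0[of "x - L"] x by (simp add: truncated_RL_def)
  qed
  \<comment> \<open>Now the variable \<open>x\<close> occurs only inside \<Phi>, which has a
    continuous derivative there, so the Leibniz rule applies. The kernel is harmless because
    \<open>u\<close> stays above \<open>e > 0\<close>.\<close>
  have "((\<lambda>x. integral (cbox e L) (\<lambda>u. u powr (-\<alpha> - 1) *\<^sub>R \<Phi> (x - u))) has_vector_derivative
      integral (cbox e L) (\<lambda>u. u powr (-\<alpha> - 1) *\<^sub>R h (t - u))) (at t within {t0..t0 + L})"
  proof (rule leibniz_rule_vector_derivative)
    show "continuous_on ({t0..t0 + L} \<times> cbox e L) (\<lambda>(x, u). u powr (-\<alpha> - 1) *\<^sub>R h (x - u))"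
      unfolding cbox_interval by (rule cont2) (rule continuous_on_subset[OF h(1)], simp)
    show "((\<lambda>x. u powr (-\<alpha> - 1) *\<^sub>R \<Phi> (x - u)) has_vector_derivative u powr (-\<alpha> - 1) *\<^sub>R h (x - u))
        (at x within {t0..t0 + L})" if "x \<in> {t0..t0 + L}" "u \<in> cbox e L" for x u
      using bounded_linear.has_vector_derivative[OF bounded_linear_scaleR_right \<Phi>_t] that by simp
  qed (use t integrable in auto)
  then have "((\<lambda>x. e powr (-\<alpha>) *\<^sub>R \<Phi> (x - e) - \<alpha> *\<^sub>R integral {e..L} (\<lambda>u. u powr (-\<alpha> - 1) *\<^sub>R \<Phi> (x - u)))
      has_vector_derivative truncated_Marchaud \<alpha> L e h t) (at t within {t0..t0 + L})"
    unfolding truncated_Marchaud_def using t e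
    by (intro has_vector_derivative_diff
        bounded_linear.has_vector_derivative[OF bounded_linear_scaleR_right] \<Phi>_t) auto
  then show ?thesis
    by (rule has_vector_derivative_transform[rotated 2]) (use t parts in auto)
qed

lemma continuous_on_truncated_Marchaud:
  fixes h :: "real \<Rightarrow> 'a::banach"
  assumes h: "continuous_on UNIV h" and e: "0 < e"
  shows "continuous_on S (truncated_Marchaud \<alpha> L e h)"
proof -
  have "continuous_on (S \<times> cbox e L) (\<lambda>(x, u). u powr (-\<alpha> - 1) *\<^sub>R h (x - u))"
    unfolding case_prod_beta using e
    by (intro continuous_intros continuous_on_compose2[OF h]) auto
  from integral_continuous_on_param[OF this]
  have "continuous_on S (\<lambda>x. integral {e..L} (\<lambda>u. u powr (-\<alpha> - 1) *\<^sub>R h (x - u)))"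
    by simp
  then show ?thesis
    unfolding truncated_Marchaud_def[abs_def]
    by (intro continuous_intros continuous_on_compose2[OF h]) auto
qed

section \<open>Convergence rates of the truncations\<close>

text \<open>A bounded \<open>h\<close> times the kernel has a singularity of order
  \<open>p - 1\<close> with \<open>p = 1 - \<alpha>\<close>. Truncating at \<open>e\<close> removes
  the piece \<open>{t - e..t}\<close>, whose contribution is the stated error.\<close>

lemma J_kernel_bochner:
  fixes h :: "real \<Rightarrow> 'a::banach"
  assumes h: "continuous_on UNIV h" "\<And>s. s \<le> t0 \<Longrightarrow> h s = 0"
    and B: "\<And>s. s \<in> {t0..t0 + L} \<Longrightarrow> norm (h s) \<le> B"
    and \<alpha>: "\<alpha> < 1" and t: "t \<in> {t0..t0 + L}"
  obtains y where "bochner_has_integral (lebesgue_on {t0..t}) (J_kernel \<alpha> h t) y"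
    "\<And>e. 0 < e \<Longrightarrow> e < L \<Longrightarrow> norm (y - truncated_RL \<alpha> L e h t) \<le> B * (e powr (1 - \<alpha>) / (1 - \<alpha>))"
proof -
  have "0 \<le> norm (h t)" by simp
  also have "\<dots> \<le> B" by (rule B[OF t])
  finally have B_nonneg: "0 \<le> B" .
  show ?thesis
  proof (cases "t = t0")
    case True
    have "norm (0 - truncated_RL \<alpha> L e h t) \<le> B * (e powr (1 - \<alpha>) / (1 - \<alpha>))" if "0 < e" for e
    proof -
      have "truncated_RL \<alpha> L e h t = 0"
        unfolding truncated_RL_def using True that by (intro integral_delayed_eq_0[OF h(2), of t0]) auto
      then show ?thesis using B_nonneg \<alpha> by simp
    qed
    then show ?thesis
      using that[of 0] bochner_has_integral_singleton True by blast
  next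
    case False
    with t have t0: "t0 < t" by simp
    have "continuous_on {t0..<t} (J_kernel \<alpha> h t)"
      unfolding J_kernel_def[abs_def]
      by (intro continuous_intros continuous_on_subset[OF h(1)]) auto
    moreover have "norm (J_kernel \<alpha> h t s) \<le> B * (t - s) powr (1 - \<alpha> - 1)" if "s \<in> {t0..<t}" for s
      using B[of s] that t by (simp add: J_kernel_def mult.commute mult_right_mono)
    ultimately obtain y where y: "bochner_has_integral (lebesgue_on {t0..t}) (J_kernel \<alpha> h t) y"
      "\<And>c. c \<in> {t0..<t} \<Longrightarrow>
         norm (y - integral {t0..c} (J_kernel \<alpha> h t)) \<le> B * ((t - c) powr (1 - \<alpha>) / (1 - \<alpha>))"
      using bochner_has_integral_singular[OF t0, of "1 - \<alpha>"] \<alpha> by (metis diff_gt_0_iff_gt)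
    have "norm (y - truncated_RL \<alpha> L e h t) \<le> B * (e powr (1 - \<alpha>) / (1 - \<alpha>))"
      if e: "0 < e" "e < L" for e
    proof (cases "e \<le> t - t0")
      case True
      have "truncated_RL \<alpha> L e h t = integral {t0..t - e} (J_kernel \<alpha> h t)"
        unfolding truncated_RL_def J_kernel_def[abs_def] using e t True
        by (intro integral_delayed[OF h]) (auto intro!: continuous_intros)
      then show ?thesis
        using y(2)[of "t - e"] e True by simp
    next
      case False
      \<comment> \<open>The cut removes the whole interval \<open>{t0..t}\<close>, so the error is
        the full integral, controlled by the tail estimate at \<open>c = t0\<close>.\<close>
      then have "truncated_RL \<alpha> L e h t = 0"
        unfolding truncated_RL_def by (intro integral_delayed_eq_0[OF h(2), of t0]) auto
      then have "norm (y - truncated_RL \<alpha> L e h t) \<le> B * ((t - t0) powr (1 - \<alpha>) / (1 - \<alpha>))"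
        using y(2)[of t0] t0 by simp
      also have "\<dots> \<le> B * (e powr (1 - \<alpha>) / (1 - \<alpha>))"
        using False t0 \<alpha> B_nonneg
        by (intro mult_left_mono divide_right_mono powr_mono2) auto
      finally show ?thesis .
    qed
    then show ?thesis using that y(1) by blast
  qed
qed

text \<open>The Hoelder condition weakens the singularity from order \<open>-\<alpha> - 1\<close> to
  \<open>\<beta> - \<alpha> - 1\<close>, which is integrable as \<alpha> < \<beta>. In the
  comparison with the truncation, the integral of the kernel times the constant \<open>h t\<close>
  is explicit and cancels the boundary term at \<open>t0\<close>. What remains is a tail of the
  Marchaud integral and one increment of \<open>h\<close> over the distance
  \<open>e\<close>.\<close>

lemma Marchaud_kernel_bochner:
  fixes h :: "real \<Rightarrow> 'a::banach"
  assumes h: "\<And>s t. norm (h s - h t) \<le> H * \<bar>s - t\<bar> powr \<beta>" "\<And>s. s \<le> t0 \<Longrightarrow> h s = 0"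
    and cont: "continuous_on UNIV h"
    and \<alpha>: "0 < \<alpha>" "\<alpha> < \<beta>" and t: "t0 < t" "t \<le> t0 + L"
  obtains y where "bochner_has_integral (lebesgue_on {t0..t}) (Marchaud_kernel \<alpha> h t) y"
    "norm ((-\<alpha>) *\<^sub>R y + (t - t0) powr (-\<alpha>) *\<^sub>R h t) \<le> H * (\<alpha> / (\<beta> - \<alpha>) + 1) * (t - t0) powr (\<beta> - \<alpha>)"
    "\<And>e. 0 < e \<Longrightarrow> e < L \<Longrightarrow>
       norm ((-\<alpha>) *\<^sub>R y + (t - t0) powr (-\<alpha>) *\<^sub>R h t - truncated_Marchaud \<alpha> L e h t)
         \<le> H * (\<alpha> / (\<beta> - \<alpha>) + 1) * e powr (\<beta> - \<alpha>)"
proof -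
  have H: "0 \<le> H"
    using order_trans[OF norm_ge_zero h(1)[of 1 0]] by simp
  have "continuous_on {t0..<t} (Marchaud_kernel \<alpha> h t)"
    unfolding Marchaud_kernel_def[abs_def]
    by (intro continuous_intros continuous_on_subset[OF cont]) auto
  moreover have "norm (Marchaud_kernel \<alpha> h t s) \<le> H * (t - s) powr (\<beta> - \<alpha> - 1)" if "s \<in> {t0..<t}" for s
  proof -
    have "norm (Marchaud_kernel \<alpha> h t s) \<le> (t - s) powr (-\<alpha> - 1) * (H * (t - s) powr \<beta>)"
      using h(1)[of s t] that by (simp add: Marchaud_kernel_def mult_left_mono)
    also have "\<dots> = H * (t - s) powr (\<beta> - \<alpha> - 1)"
      using that by (simp flip: powr_add add: algebra_simps)
    finally show ?thesis .
  qed
  ultimately obtain y where y: "bochner_has_integral (lebesgue_on {t0..t}) (Marchaud_kernel \<alpha> h t) y"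
    "\<And>c. c \<in> {t0..<t} \<Longrightarrow>
       norm (y - integral {t0..c} (Marchaud_kernel \<alpha> h t)) \<le> H * ((t - c) powr (\<beta> - \<alpha>) / (\<beta> - \<alpha>))"
    using bochner_has_integral_singular[OF t(1), of "\<beta> - \<alpha>"] \<alpha> by (metis diff_gt_0_iff_gt)
  \<comment> \<open>The source of the constant: \<open>\<alpha> / (\<beta> - \<alpha>)\<close> stems
    from the tail of the integral, 1 from the increment of \<open>h\<close>. Used with
    \<open>d = t - t0\<close> for the size of the derivative and with \<open>d = e\<close> for the
    truncation error.\<close>
  have combine: "norm ((-\<alpha>) *\<^sub>R z + w) \<le> H * (\<alpha> / (\<beta> - \<alpha>) + 1) * d powr (\<beta> - \<alpha>)"
    if "norm z \<le> H * (d powr (\<beta> - \<alpha>) / (\<beta> - \<alpha>))" "norm w \<le> d powr (-\<alpha>) * (H * d powr \<beta>)" "0 < d"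
    for z w :: 'a and d
  proof -
    have "d powr (-\<alpha>) * (H * d powr \<beta>) = H * d powr (\<beta> - \<alpha>)"
      using that(3) by (simp flip: powr_add add: algebra_simps)
    then have "norm w \<le> H * d powr (\<beta> - \<alpha>)"
      using that(2) by (simp only:)
    moreover have "norm ((-\<alpha>) *\<^sub>R z) \<le> \<alpha> * (H * (d powr (\<beta> - \<alpha>) / (\<beta> - \<alpha>)))"
      using mult_left_mono[OF that(1), of \<alpha>] \<alpha> by simp
    ultimately have "norm ((-\<alpha>) *\<^sub>R z + w)
        \<le> \<alpha> * (H * (d powr (\<beta> - \<alpha>) / (\<beta> - \<alpha>))) + H * d powr (\<beta> - \<alpha>)"
      by (intro norm_triangle_le add_mono)
    also have "\<dots> = H * (\<alpha> / (\<beta> - \<alpha>) + 1) * d powr (\<beta> - \<alpha>)"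
      by (simp add: algebra_simps)
    finally show ?thesis .
  qed
  have h_t: "norm (h t) \<le> H * (t - t0) powr \<beta>"
    using h(1)[of t t0] h(2)[of t0] t by simp
  have bound: "norm ((-\<alpha>) *\<^sub>R y + (t - t0) powr (-\<alpha>) *\<^sub>R h t) \<le> H * (\<alpha> / (\<beta> - \<alpha>) + 1) * (t - t0) powr (\<beta> - \<alpha>)"
    using y(2)[of t0] t h_t by (intro combine) (auto intro!: mult_left_mono)
  have approx: "norm ((-\<alpha>) *\<^sub>R y + (t - t0) powr (-\<alpha>) *\<^sub>R h t - truncated_Marchaud \<alpha> L e h t)
         \<le> H * (\<alpha> / (\<beta> - \<alpha>) + 1) * e powr (\<beta> - \<alpha>)" if e: "0 < e" "e < L" for e
  proof (cases "e \<le> t - t0")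
    case True
    define I where "I = integral {t0..t - e} (Marchaud_kernel \<alpha> h t)"
    \<comment> \<open>Exact integral of the kernel away from its singularity. It converts the
      integral of \<open>h s\<close> in the truncation into one of \<open>h s - h t\<close>.\<close>
    have "((\<lambda>u. u powr (-\<alpha> - 1)) has_integral
        (- ((t - t0) powr (-\<alpha>)) / \<alpha> - - (e powr (-\<alpha>)) / \<alpha>)) {e..t - t0}"
      using e True \<alpha>
      by (intro fundamental_theorem_of_calculus)
        (auto intro!: derivative_eq_intros simp flip: has_real_derivative_iff_has_vector_derivative)
    from has_integral_reflect_shift[OF this, of t]
    have "((\<lambda>s. (t - s) powr (-\<alpha> - 1)) has_integral (e powr (-\<alpha>) - (t - t0) powr (-\<alpha>)) / \<alpha>) {t0..t - e}"
      by (simp add: diff_divide_distrib)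
    then have const: "((\<lambda>s. (t - s) powr (-\<alpha> - 1) *\<^sub>R h t) has_integral
        ((e powr (-\<alpha>) - (t - t0) powr (-\<alpha>)) / \<alpha>) *\<^sub>R h t) {t0..t - e}"
      by (rule has_integral_scaleR_left)
    have "Marchaud_kernel \<alpha> h t integrable_on {t0..t - e}"
      unfolding Marchaud_kernel_def[abs_def] using e
      by (intro integrable_continuous_real continuous_intros continuous_on_subset[OF cont]) auto
    from has_integral_add[OF integrable_integral[OF this] const]
    have "((\<lambda>s. (t - s) powr (-\<alpha> - 1) *\<^sub>R h s) has_integral
        I + ((e powr (-\<alpha>) - (t - t0) powr (-\<alpha>)) / \<alpha>) *\<^sub>R h t) {t0..t - e}"
      by (simp add: I_def Marchaud_kernel_def algebra_simps)
    moreover have "integral {e..L} (\<lambda>u. u powr (-\<alpha> - 1) *\<^sub>R h (t - u))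
        = integral {t0..t - e} (\<lambda>s. (t - s) powr (-\<alpha> - 1) *\<^sub>R h s)"
      using e t True by (intro integral_delayed[OF cont h(2)]) (auto intro!: continuous_intros)
    ultimately have "truncated_Marchaud \<alpha> L e h t = e powr (-\<alpha>) *\<^sub>R h (t - e)
        - \<alpha> *\<^sub>R (I + ((e powr (-\<alpha>) - (t - t0) powr (-\<alpha>)) / \<alpha>) *\<^sub>R h t)"
      by (simp add: truncated_Marchaud_def integral_unique)
    also have "\<dots> = e powr (-\<alpha>) *\<^sub>R h (t - e) - (\<alpha> *\<^sub>R I + (e powr (-\<alpha>) - (t - t0) powr (-\<alpha>)) *\<^sub>R h t)"
      using \<alpha> by (simp add: scaleR_add_right)
    finally have "(-\<alpha>) *\<^sub>R y + (t - t0) powr (-\<alpha>) *\<^sub>R h t - truncated_Marchaud \<alpha> L e h t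
        = (-\<alpha>) *\<^sub>R (y - I) + e powr (-\<alpha>) *\<^sub>R (h t - h (t - e))"
      by (simp add: algebra_simps)
    also have "norm \<dots> \<le> H * (\<alpha> / (\<beta> - \<alpha>) + 1) * e powr (\<beta> - \<alpha>)"
    proof (rule combine)
      show "norm (y - I) \<le> H * (e powr (\<beta> - \<alpha>) / (\<beta> - \<alpha>))"
        using y(2)[of "t - e"] e True by (simp add: I_def)
      show "norm (e powr (-\<alpha>) *\<^sub>R (h t - h (t - e))) \<le> e powr (-\<alpha>) * (H * e powr \<beta>)"
        using h(1)[of t "t - e"] e by (simp add: mult_left_mono)
    qed fact
    finally show ?thesis .
  next
    case False
    \<comment> \<open>Here \<open>t - e \<le> t0\<close>, so the truncation vanishes altogether. The
      error is the full value, which is small because \<open>t - t0 < e\<close>.\<close>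
    then have "integral {e..L} (\<lambda>u. u powr (-\<alpha> - 1) *\<^sub>R h (t - u)) = 0"
      by (intro integral_delayed_eq_0[OF h(2), of t0]) auto
    then have "truncated_Marchaud \<alpha> L e h t = 0"
      unfolding truncated_Marchaud_def using h(2)[of "t - e"] False by simp
    then have "norm ((-\<alpha>) *\<^sub>R y + (t - t0) powr (-\<alpha>) *\<^sub>R h t - truncated_Marchaud \<alpha> L e h t)
         \<le> H * (\<alpha> / (\<beta> - \<alpha>) + 1) * (t - t0) powr (\<beta> - \<alpha>)"
      using bound by simp
    also have "\<dots> \<le> H * (\<alpha> / (\<beta> - \<alpha>) + 1) * e powr (\<beta> - \<alpha>)"
      using False t \<alpha> H by (intro mult_left_mono powr_mono2) auto
    finally show ?thesis .
  qed
  show ?thesis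
    using that[OF y(1) bound approx] .
qed

section \<open>Passing to the limit in the truncation\<close>

lemma tendsto_powr_0:
  fixes f :: "'b \<Rightarrow> real"
  assumes "(f \<longlongrightarrow> 0) F" "\<And>x. 0 \<le> f x" "0 < p"
  shows "((\<lambda>x. f x powr p) \<longlongrightarrow> 0) F"
  using tendsto_powr'[OF assms(1) tendsto_const[of p]] assms(2,3) by simp

lemma Holder_continuous_on:
  fixes h :: "real \<Rightarrow> 'a::real_normed_vector"
  assumes "\<And>s t. s \<in> S \<Longrightarrow> t \<in> S \<Longrightarrow> norm (h s - h t) \<le> H * \<bar>s - t\<bar> powr \<beta>" "0 < \<beta>"
  shows "continuous_on S h"
  unfolding continuous_on_def
proof
  fix t assume t: "t \<in> S"
  have "((\<lambda>s. \<bar>s - t\<bar>) \<longlongrightarrow> \<bar>t - t\<bar>) (at t within S)"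
    by (intro tendsto_intros)
  then have "((\<lambda>s. \<bar>s - t\<bar> powr \<beta>) \<longlongrightarrow> 0) (at t within S)"
    using assms(2) by (intro tendsto_powr_0) auto
  from tendsto_mult[OF tendsto_const this, of H]
  have "((\<lambda>s. H * \<bar>s - t\<bar> powr \<beta>) \<longlongrightarrow> 0) (at t within S)" by simp
  then have "((\<lambda>s. h s - h t) \<longlongrightarrow> 0) (at t within S)"
    by (rule Lim_null_comparison[rotated])
      (use t assms(1) in \<open>auto simp: eventually_at_filter\<close>)
  then show "(h \<longlongrightarrow> h t) (at t within S)"
    by (simp add: LIM_zero_iff)
qed

definition Marchaud_derivative :: "real \<Rightarrow> real \<Rightarrow> (real \<Rightarrow> 'a::banach) \<Rightarrow> real \<Rightarrow> 'a" where
  "Marchaud_derivative \<alpha> t0 f t =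
     (-\<alpha>) *\<^sub>R bochner_integral (lebesgue_on {t0..t}) (Marchaud_kernel \<alpha> f t) + (t - t0) powr (-\<alpha>) *\<^sub>R f t"

lemma Marchaud_formula_eq:
  "Marchaud_formula \<alpha> t0 f t = (1 / Gamma (1 - \<alpha>)) *\<^sub>R Marchaud_derivative \<alpha> t0 f t"
  by (simp add: Marchaud_formula_def Marchaud_derivative_def scaleR_diff_right)

text \<open>The rates of both truncations depend on \<open>e\<close> but not on \<open>t\<close>.
  Thus the truncated derivatives converge uniformly, which gives continuity of the limit and, with
  the convergence of the truncated integrals, allows termwise differentiation.\<close>

lemma fractional_derivative_Holder:
  fixes h :: "real \<Rightarrow> 'a::banach"
  assumes h: "\<And>s t. norm (h s - h t) \<le> H * \<bar>s - t\<bar> powr \<beta>" and h0: "\<forall>s\<le>t0. h s = 0"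
    and \<alpha>: "0 < \<alpha>" "\<alpha> < \<beta>" "\<alpha> < 1" and L: "0 < L"
  shows "t \<in> {t0..t0 + L} \<Longrightarrow> bochner_integrable (lebesgue_on {t0..t}) (J_kernel \<alpha> h t)"
    and "t \<in> {t0..t0 + L} \<Longrightarrow> bochner_integrable (lebesgue_on {t0..t}) (Marchaud_kernel \<alpha> h t)"
    and "t \<in> {t0..t0 + L} \<Longrightarrow>
      norm (Marchaud_derivative \<alpha> t0 h t) \<le> H * (\<alpha> / (\<beta> - \<alpha>) + 1) * (t - t0) powr (\<beta> - \<alpha>)"
    and "continuous_on {t0..t0 + L} (Marchaud_derivative \<alpha> t0 h)"
    and "t \<in> {t0..t0 + L} \<Longrightarrow>
      ((\<lambda>t. bochner_integral (lebesgue_on {t0..t}) (J_kernel \<alpha> h t))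
        has_vector_derivative Marchaud_derivative \<alpha> t0 h t) (at t within {t0..t0 + L})"
proof -
  have h_eq_0: "h s = 0" if "s \<le> t0" for s
    using h0 that by blast
  let ?T = "{t0..t0 + L}"
  let ?J = "\<lambda>t. bochner_integral (lebesgue_on {t0..t}) (J_kernel \<alpha> h t)"
  let ?m = "Marchaud_derivative \<alpha> t0 h"
  define K where "K = H * (\<alpha> / (\<beta> - \<alpha>) + 1)"
  have H: "0 \<le> H"
    using order_trans[OF norm_ge_zero h[of 1 0]] by simp
  then have K: "0 \<le> K" using \<alpha> by (simp add: K_def)
  have cont: "continuous_on UNIV h"
    using h \<alpha> by (intro Holder_continuous_on[of _ _ H \<beta>]) auto
  \<comment> \<open>As \<open>h t0 = 0\<close>, the Hoelder condition relative to \<open>t0\<close>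
    also bounds \<open>h\<close> itself.\<close>
  define B where "B = H * L powr \<beta>"
  have B: "norm (h s) \<le> B" if "s \<in> ?T" for s
  proof -
    have "norm (h s) \<le> H * (s - t0) powr \<beta>"
      using h[of s t0] h_eq_0[of t0] that by simp
    also have "\<dots> \<le> B"
      unfolding B_def using that H \<alpha> by (intro mult_left_mono powr_mono2) auto
    finally show ?thesis .
  qed
  have J: "bochner_integrable (lebesgue_on {t0..t}) (J_kernel \<alpha> h t)"
    "\<And>e. 0 < e \<Longrightarrow> e < L \<Longrightarrow> norm (?J t - truncated_RL \<alpha> L e h t) \<le> B * (e powr (1 - \<alpha>) / (1 - \<alpha>))"
    if t: "t \<in> ?T" for t
  proof -
    obtain y where y: "bochner_has_integral (lebesgue_on {t0..t}) (J_kernel \<alpha> h t) y"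
      "\<And>e. 0 < e \<Longrightarrow> e < L \<Longrightarrow> norm (y - truncated_RL \<alpha> L e h t) \<le> B * (e powr (1 - \<alpha>) / (1 - \<alpha>))"
      using J_kernel_bochner[OF cont h_eq_0 B \<alpha>(3) t] by blast
    then show "bochner_integrable (lebesgue_on {t0..t}) (J_kernel \<alpha> h t)"
      by (auto simp: bochner_integrable_def)
    show "norm (?J t - truncated_RL \<alpha> L e h t) \<le> B * (e powr (1 - \<alpha>) / (1 - \<alpha>))" if "0 < e" "e < L" for e
      using y(2)[OF that] by (simp add: bochner_integral_eqI[OF y(1)])
  qed
  have M: "bochner_integrable (lebesgue_on {t0..t}) (Marchaud_kernel \<alpha> h t)"
    "norm (?m t) \<le> K * (t - t0) powr (\<beta> - \<alpha>)"
    "\<And>e. 0 < e \<Longrightarrow> e < L \<Longrightarrow> norm (?m t - truncated_Marchaud \<alpha> L e h t) \<le> K * e powr (\<beta> - \<alpha>)"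
    if t: "t \<in> ?T" for t
  proof -
    have "bochner_integrable (lebesgue_on {t0..t}) (Marchaud_kernel \<alpha> h t) \<and>
      norm (?m t) \<le> K * (t - t0) powr (\<beta> - \<alpha>) \<and>
      (\<forall>e. 0 < e \<longrightarrow> e < L \<longrightarrow> norm (?m t - truncated_Marchaud \<alpha> L e h t) \<le> K * e powr (\<beta> - \<alpha>))"
    proof (cases "t = t0")
      case True
      \<comment> \<open>At \<open>t = t0\<close> everything is 0: the delayed arguments lie left of
        \<open>t0\<close>, the integral is over a single point, and the remaining term is a multiple
        of \<open>h t0 = 0\<close>.\<close>
      have "truncated_Marchaud \<alpha> L e h t0 = 0" if "0 < e" for e
      proof -
        have "integral {e..L} (\<lambda>u. u powr (-\<alpha> - 1) *\<^sub>R h (t0 - u)) = 0"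
          using that by (intro integral_delayed_eq_0[OF h_eq_0, of t0]) auto
        then show ?thesis
          unfolding truncated_Marchaud_def using h_eq_0[of "t0 - e"] that by simp
      qed
      moreover have "?m t0 = 0"
        unfolding Marchaud_derivative_def bochner_integral_eqI[OF bochner_has_integral_singleton] by simp
      moreover have "bochner_integrable (lebesgue_on {t0..t0}) (Marchaud_kernel \<alpha> h t0)"
        unfolding bochner_integrable_def using bochner_has_integral_singleton by (rule exI)
      ultimately show ?thesis
        using True K by simp
    next
      case False
      with t have t': "t0 < t" "t \<le> t0 + L" by auto
      obtain y where y: "bochner_has_integral (lebesgue_on {t0..t}) (Marchaud_kernel \<alpha> h t) y"
        "norm ((-\<alpha>) *\<^sub>R y + (t - t0) powr (-\<alpha>) *\<^sub>R h t) \<le> K * (t - t0) powr (\<beta> - \<alpha>)"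
        "\<And>e. 0 < e \<Longrightarrow> e < L \<Longrightarrow>
           norm ((-\<alpha>) *\<^sub>R y + (t - t0) powr (-\<alpha>) *\<^sub>R h t - truncated_Marchaud \<alpha> L e h t) \<le> K * e powr (\<beta> - \<alpha>)"
        using Marchaud_kernel_bochner[OF h h_eq_0 cont \<alpha>(1,2) t', folded K_def] by blast
      then show ?thesis
        unfolding Marchaud_derivative_def bochner_integral_eqI[OF y(1)]
        by (auto simp only: bochner_integrable_def)
    qed
    then show "bochner_integrable (lebesgue_on {t0..t}) (Marchaud_kernel \<alpha> h t)"
      "norm (?m t) \<le> K * (t - t0) powr (\<beta> - \<alpha>)"
      "\<And>e. 0 < e \<Longrightarrow> e < L \<Longrightarrow> norm (?m t - truncated_Marchaud \<alpha> L e h t) \<le> K * e powr (\<beta> - \<alpha>)"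
      by blast+
  qed
  \<comment> \<open>A null sequence; the double \<open>Suc\<close> keeps \<open>e n\<close> strictly
    below \<open>L\<close> already at \<open>n = 0\<close>.\<close>
  define e where "e n = L * inverse (real (Suc (Suc n)))" for n
  have e_bounds: "0 < e n" "e n < L" for n
    using L by (simp_all add: e_def field_simps add_pos_nonneg)
  have e_lim: "e \<longlonglongrightarrow> 0"
  proof -
    have "(\<lambda>n. L * inverse (real (Suc (Suc n)))) \<longlonglongrightarrow> L * 0"
      by (rule tendsto_mult[OF tendsto_const LIMSEQ_Suc[OF LIMSEQ_inverse_real_of_nat]])
    then show ?thesis by (simp add: e_def[abs_def])
  qed
  have e_powr: "(\<lambda>n. e n powr p) \<longlonglongrightarrow> 0" if "0 < p" for p
    using e_bounds that by (intro tendsto_powr_0 e_lim) (auto intro: less_imp_le)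
  have rate: "(\<lambda>n. K * e n powr (\<beta> - \<alpha>)) \<longlonglongrightarrow> 0"
    using tendsto_mult[OF tendsto_const[of K] e_powr[of "\<beta> - \<alpha>"]] \<alpha> by simp
  have uniform: "\<forall>\<^sub>F n in sequentially. \<forall>t\<in>?T. norm (truncated_Marchaud \<alpha> L (e n) h t - ?m t) < \<epsilon>"
    if "0 < \<epsilon>" for \<epsilon>
    using order_tendstoD(2)[OF rate that]
  proof eventually_elim
    case (elim n)
    show ?case
      using M(3)[OF _ e_bounds, of _ n] elim by (force simp: norm_minus_commute)
  qed
  have "uniform_limit ?T (\<lambda>n. truncated_Marchaud \<alpha> L (e n) h) ?m sequentially"
    by (rule uniform_limitI) (use uniform in \<open>simp add: dist_norm\<close>)
  then show "continuous_on ?T ?m"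
    by (rule uniform_limit_theorem[rotated])
      (auto intro!: always_eventually continuous_on_truncated_Marchaud[OF cont] e_bounds)
  have J_lim: "(\<lambda>n. truncated_RL \<alpha> L (e n) h t) \<longlonglongrightarrow> ?J t" if t: "t \<in> ?T" for t
  proof -
    have "(\<lambda>n. B * (e n powr (1 - \<alpha>) / (1 - \<alpha>))) \<longlonglongrightarrow> B * (0 / (1 - \<alpha>))"
      using \<alpha> by (intro tendsto_mult[OF tendsto_const] tendsto_divide[OF e_powr tendsto_const]) auto
    then have "(\<lambda>n. B * (e n powr (1 - \<alpha>) / (1 - \<alpha>))) \<longlonglongrightarrow> 0" by simp
    moreover have "norm (truncated_RL \<alpha> L (e n) h t - ?J t) \<le> B * (e n powr (1 - \<alpha>) / (1 - \<alpha>))" for n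
      using J(2)[OF t e_bounds, of n] by (simp only: norm_minus_commute)
    ultimately have "(\<lambda>n. truncated_RL \<alpha> L (e n) h t - ?J t) \<longlonglongrightarrow> 0"
      by (rule Lim_null_comparison[OF always_eventually[OF allI], rotated])
    then show ?thesis by (simp add: LIM_zero_iff)
  qed
  \<comment> \<open>Exchange of limit and derivative: the derivatives converge uniformly on the
    interval, and the functions converge at \<open>t0\<close>.\<close>
  have "\<exists>g. \<forall>t\<in>?T. (\<lambda>n. truncated_RL \<alpha> L (e n) h t) \<longlonglongrightarrow> g t \<and>
      (g has_derivative (\<lambda>x. x *\<^sub>R ?m t)) (at t within ?T)"
  proof (rule has_derivative_sequence)
    show "(truncated_RL \<alpha> L (e n) h has_derivative (\<lambda>x. x *\<^sub>R truncated_Marchaud \<alpha> L (e n) h t)) (at t within ?T)"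
      if "t \<in> ?T" for n t
      using truncated_RL_has_vector_derivative[OF cont h_eq_0 e_bounds that]
      by (simp add: has_vector_derivative_def)
    show "\<forall>\<^sub>F n in sequentially. \<forall>t\<in>?T. \<forall>x.
        norm (x *\<^sub>R truncated_Marchaud \<alpha> L (e n) h t - x *\<^sub>R ?m t) \<le> \<epsilon> * norm x" if "0 < \<epsilon>" for \<epsilon>
      using uniform[OF that]
    proof eventually_elim
      case (elim n)
      show ?case
      proof (intro ballI allI)
        fix t x :: real assume "t \<in> ?T"
        then have "norm (truncated_Marchaud \<alpha> L (e n) h t - ?m t) \<le> \<epsilon>"
          using elim by (auto intro: less_imp_le)
        from mult_right_mono[OF this, of "norm x"] show "norm (x *\<^sub>R truncated_Marchaud \<alpha> L (e n) h t - x *\<^sub>R ?m t) \<le> \<epsilon> * norm x"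
          by (simp add: mult.commute flip: scaleR_diff_right)
      qed
    qed
    show "t0 \<in> ?T" using L by simp
    then show "(\<lambda>n. truncated_RL \<alpha> L (e n) h t0) \<longlonglongrightarrow> ?J t0" by (rule J_lim)
  qed simp
  then obtain g where g: "\<And>t. t \<in> ?T \<Longrightarrow> (\<lambda>n. truncated_RL \<alpha> L (e n) h t) \<longlonglongrightarrow> g t"
      "\<And>t. t \<in> ?T \<Longrightarrow> (g has_vector_derivative ?m t) (at t within ?T)"
    unfolding has_vector_derivative_def by blast
  \<comment> \<open>The limit function \<open>g\<close> is the fractional integral, since both are
    pointwise limits of the truncations.\<close>
  show "(?J has_vector_derivative ?m t) (at t within ?T)" if "t \<in> ?T"
    by (rule has_vector_derivative_transform[OF that _ g(2)[OF that]])
      (rule LIMSEQ_unique[OF J_lim g(1)])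
  show "t \<in> ?T \<Longrightarrow> bochner_integrable (lebesgue_on {t0..t}) (J_kernel \<alpha> h t)"
    by (rule J)
  show "t \<in> ?T \<Longrightarrow> bochner_integrable (lebesgue_on {t0..t}) (Marchaud_kernel \<alpha> h t)"
    by (rule M)
  show "t \<in> ?T \<Longrightarrow> norm (?m t) \<le> H * (\<alpha> / (\<beta> - \<alpha>) + 1) * (t - t0) powr (\<beta> - \<alpha>)"
    using M(2) by (simp add: K_def)
qed

section \<open>Smooth bump functions and weak derivatives\<close>

text \<open>The polynomial parameter closes the family under differentiation. It contains
  \<open>exp (- 1 / x)\<close>, extended by 0, as the case \<open>p = 1\<close>.\<close>

definition flat :: "real poly \<Rightarrow> real \<Rightarrow> real" where
  "flat p x = (if 0 < x then poly p (inverse x) * exp (- inverse x) else 0)"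

lemma flat_nonpos: "x \<le> 0 \<Longrightarrow> flat p x = 0"
  by (simp add: flat_def)

lemma poly_times_exp_tendsto_0: "((\<lambda>x::real. poly p x * exp (- x)) \<longlongrightarrow> 0) at_top"
proof -
  have "((\<lambda>x. \<Sum>i\<le>degree p. coeff p i * (x ^ i / exp x)) \<longlongrightarrow> (\<Sum>i\<le>degree p. coeff p i * 0)) at_top"
    by (intro tendsto_intros tendsto_power_div_exp_0)
  then show ?thesis
    by (simp add: poly_altdef exp_minus field_simps sum_divide_distrib sum_distrib_left)
qed

lemma flat_tendsto_0: "(flat p \<longlongrightarrow> 0) (at 0)"
proof (rule filterlim_split_at)
  show "(flat p \<longlongrightarrow> 0) (at_left 0)"
    by (rule tendsto_eventually) (auto simp: flat_def eventually_at_filter)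
  have "((\<lambda>x. poly p (inverse x) * exp (- inverse x)) \<longlongrightarrow> 0) (at_right 0)"
    by (rule filterlim_compose[OF poly_times_exp_tendsto_0 filterlim_inverse_at_top_right])
  then show "(flat p \<longlongrightarrow> 0) (at_right 0)"
    by (rule Lim_transform_eventually) (auto simp: flat_def eventually_at_filter)
qed

text \<open>With \<open>y = 1 / x\<close>, the product and chain rules give
  \<open>y\<^sup>2 * (p y - p' y) * exp (- y)\<close> for \<open>x > 0\<close>; the factor
  \<open>[:0, 0, 1:]\<close> is the polynomial \<open>y\<^sup>2\<close>.\<close>

lemma flat_has_real_derivative:
  "(flat p has_real_derivative flat ([:0, 0, 1:] * (p - pderiv p)) x) (at x)"
proof -
  consider "x < 0" | "x = 0" | "0 < x" by linarith
  then show ?thesis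
  proof cases
    case 1
    have d: "((\<lambda>_. 0) has_real_derivative flat ([:0, 0, 1:] * (p - pderiv p)) x) (at x)"
      using 1 by (simp only: flat_nonpos DERIV_const less_imp_le)
    have ev: "eventually (\<lambda>y. flat p y = 0) (nhds x)"
      using eventually_nhds_in_open[of "{..<0}" x] 1
      by (auto simp: flat_nonpos elim!: eventually_mono)
    show ?thesis
      by (subst DERIV_cong_ev[OF refl ev refl]) (rule d)
  next
    case 2
    \<comment> \<open>Dividing by \<open>y\<close> raises the degree in \<open>1 / y\<close> by one,
      so the difference quotient is the flat function of \<open>pCons 0 p\<close>, which also tends
      to 0.\<close>
    have "((\<lambda>y. (flat p y - flat p 0) / (y - 0)) \<longlongrightarrow> 0) (at 0)"
      using flat_tendsto_0[of "pCons 0 p"]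
      by (rule Lim_transform_eventually)
        (auto simp: flat_def eventually_at_filter field_simps)
    then show ?thesis
      using 2 by (simp add: has_field_derivative_iff flat_def)
  next
    case 3
    have d: "((\<lambda>x. poly p (inverse x) * exp (- inverse x)) has_real_derivative
        flat ([:0, 0, 1:] * (p - pderiv p)) x) (at x)"
      using 3
      by (auto intro!: derivative_eq_intros DERIV_chain2[OF poly_DERIV]
          simp: flat_def power2_eq_square field_simps)
    have ev: "eventually (\<lambda>y. flat p y = poly p (inverse y) * exp (- inverse y)) (nhds x)"
      using eventually_nhds_in_open[of "{0<..}" x] 3
      by (auto simp: flat_def elim!: eventually_mono)
    show ?thesis
      by (subst DERIV_cong_ev[OF refl ev refl]) (rule d)
  qed
qed

text \<open>A class of functions closed under differentiation that contains the bump. Iterated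
  derivatives stay inside it, so smoothness follows by induction with no formula for the
  \<open>n\<close>-th derivative.\<close>

inductive flat_product_sum :: "real \<Rightarrow> real \<Rightarrow> (real \<Rightarrow> real) \<Rightarrow> bool" for a b where
  prod: "flat_product_sum a b (\<lambda>x. flat p (x - a) * flat q (b - x))"
| add: "flat_product_sum a b f \<Longrightarrow> flat_product_sum a b g \<Longrightarrow> flat_product_sum a b (\<lambda>x. f x + g x)"

lemma flat_minus: "flat (- p) x = - flat p x"
  by (simp add: flat_def)

lemma flat_product_sum_deriv:
  assumes "flat_product_sum a b f"
  shows "\<exists>g. flat_product_sum a b g \<and> (\<forall>x. (f has_real_derivative g x) (at x))"
  using assms
proof induction
  case (prod p q)
  let ?D = "\<lambda>p. [:0, 0, 1:] * (p - pderiv p)"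
  \<comment> \<open>The minus sign from the inner derivative of \<open>b - x\<close> is absorbed
    into the polynomial.\<close>
  have "flat_product_sum a b (\<lambda>x. flat (?D p) (x - a) * flat q (b - x) + flat p (x - a) * flat (- ?D q) (b - x))"
    by (intro flat_product_sum.intros)
  moreover have "((\<lambda>x. flat p (x - a) * flat q (b - x)) has_real_derivative
      flat (?D p) (x - a) * flat q (b - x) + flat p (x - a) * flat (- ?D q) (b - x)) (at x)" for x
  proof -
    have "((\<lambda>x. flat p (x - a)) has_real_derivative flat (?D p) (x - a) * 1) (at x)"
      by (rule DERIV_chain2[OF flat_has_real_derivative]) (auto intro!: derivative_eq_intros)
    moreover have "((\<lambda>x. flat q (b - x)) has_real_derivative flat (?D q) (b - x) * (-1)) (at x)"
      by (rule DERIV_chain2[OF flat_has_real_derivative]) (auto intro!: derivative_eq_intros)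
    ultimately show ?thesis
      by (rule DERIV_cong[OF DERIV_mult]) (simp only: flat_minus, simp add: mult.commute)
  qed
  ultimately show ?case by blast
next
  case (add f g)
  then obtain f' g' where "flat_product_sum a b f'" "flat_product_sum a b g'"
    "\<And>x. (f has_real_derivative f' x) (at x)" "\<And>x. (g has_real_derivative g' x) (at x)"
    by blast
  then show ?case
    by (intro exI[of _ "\<lambda>x. f' x + g' x"]) (auto intro: flat_product_sum.add DERIV_add)
qed

lemma flat_product_sum_iterated_deriv:
  assumes "flat_product_sum a b f"
  shows "flat_product_sum a b ((deriv ^^ n) f)"
proof (induction n)
  case (Suc n)
  then obtain g where "flat_product_sum a b g" "\<And>x. ((deriv ^^ n) f has_real_derivative g x) (at x)"
    using flat_product_sum_deriv by blast
  moreover from this have "deriv ((deriv ^^ n) f) = g"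
    by (intro ext DERIV_imp_deriv)
  ultimately show ?case by simp
qed (simp add: assms)

lemma bump_function:
  fixes a b c d :: real
  assumes "a < c" "c < d" "d < b"
  obtains \<phi> where "\<phi> \<in> test_functions a b" "\<And>x. 0 \<le> \<phi> x"
    "\<And>x. x \<in> {c<..<d} \<Longrightarrow> 0 < \<phi> x" "\<And>x. x \<notin> {c<..<d} \<Longrightarrow> \<phi> x = 0"
proof -
  \<comment> \<open>The classical bump: on \<open>{c<..<d}\<close> it equals
    \<open>exp (- 1 / (x - c) - 1 / (d - x))\<close>, and outside one of the two factors is
    0.\<close>
  define \<phi> where "\<phi> x = flat 1 (x - c) * flat 1 (d - x)" for x
  have pos: "0 < \<phi> x" if "x \<in> {c<..<d}" for x
    using that by (simp add: \<phi>_def flat_def)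
  have zero: "\<phi> x = 0" if "x \<notin> {c<..<d}" for x
    using that by (auto simp: \<phi>_def flat_def)
  have "flat_product_sum c d \<phi>"
    unfolding \<phi>_def by (rule flat_product_sum.prod)
  then have "flat_product_sum c d ((deriv ^^ n) \<phi>)" for n
    by (rule flat_product_sum_iterated_deriv)
  then have "(deriv ^^ n) \<phi> differentiable_on UNIV" for n
    using flat_product_sum_deriv[of c d "(deriv ^^ n) \<phi>"]
    unfolding differentiable_on_def real_differentiable_def by (auto intro: has_field_derivative_at_within)
  moreover have "\<exists>K. compact K \<and> K \<subseteq> {a<..<b} \<and> (\<forall>x. x \<notin> K \<longrightarrow> \<phi> x = 0)"
    using assms zero by (intro exI[of _ "{c..d}"]) auto
  ultimately have "\<phi> \<in> test_functions a b"
    by (simp add: test_functions_def)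
  then show ?thesis
    using that pos zero by (metis less_imp_le order_refl)
qed

lemma test_functionD:
  assumes "\<phi> \<in> test_functions a b"
  shows "(\<phi> has_real_derivative deriv \<phi> x) (at x)"
    and "continuous_on S \<phi>" and "continuous_on S (deriv \<phi>)"
    and "x \<notin> {a<..<b} \<Longrightarrow> \<phi> x = 0"
proof -
  have diff: "(deriv ^^ n) \<phi> differentiable_on UNIV" for n
    using assms by (simp add: test_functions_def)
  show "(\<phi> has_real_derivative deriv \<phi> x) (at x)"
    using diff[of 0] real_differentiable_def
    by (auto simp: differentiable_on_def DERIV_deriv_iff_real_differentiable)
  show "continuous_on S \<phi>"
    using differentiable_imp_continuous_on[OF diff[of 0]] by (auto intro: continuous_on_subset)
  show "continuous_on S (deriv \<phi>)"
    using differentiable_imp_continuous_on[OF diff[of 1]] by (auto intro: continuous_on_subset)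
  show "x \<notin> {a<..<b} \<Longrightarrow> \<phi> x = 0"
    using assms by (auto simp: test_functions_def)
qed

section \<open>Weak derivatives with continuous representatives\<close>

text \<open>The product of \<phi> and \<open>u\<close> has derivative
  \<open>\<phi> t *\<^sub>R g t + deriv \<phi> t *\<^sub>R u t\<close>, whose integral is 0 because
  \<phi> vanishes at both endpoints.\<close>

lemma has_weak_derivative_strong:
  fixes u g :: "real \<Rightarrow> 'a::banach"
  assumes ab: "a < b" and u: "\<And>t. t \<in> {a..b} \<Longrightarrow> (u has_vector_derivative g t) (at t within {a..b})"
    and g: "continuous_on {a..b} g"
  shows "has_weak_derivative a b u g"
  unfolding has_weak_derivative_def
proof (intro conjI ballI)
  have u_cont: "continuous_on {a..b} u"
    using u by (rule continuous_on_vector_derivative)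
  show "bochner_integrable (lebesgue_on {a..b}) u" "bochner_integrable (lebesgue_on {a..b}) g"
    using bochner_has_integral_continuous[OF ab] u_cont g by (auto simp: bochner_integrable_def)
  fix \<phi> assume \<phi>: "\<phi> \<in> test_functions a b"
  have "((\<lambda>t. \<phi> t *\<^sub>R g t + deriv \<phi> t *\<^sub>R u t) has_integral (\<phi> b *\<^sub>R u b - \<phi> a *\<^sub>R u a)) {a..b}"
    using ab by (intro fundamental_theorem_of_calculus has_vector_derivative_scaleR u
        has_field_derivative_at_within[OF test_functionD(1)[OF \<phi>]]) auto
  moreover have "\<phi> a = 0" "\<phi> b = 0"
    using test_functionD(4)[OF \<phi>] by auto
  ultimately have sum: "((\<lambda>t. \<phi> t *\<^sub>R g t + deriv \<phi> t *\<^sub>R u t) has_integral 0) {a..b}"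
    by simp
  have cont: "continuous_on {a..b} (\<lambda>t. deriv \<phi> t *\<^sub>R u t)" "continuous_on {a..b} (\<lambda>t. \<phi> t *\<^sub>R g t)"
    by (intro continuous_intros test_functionD[OF \<phi>] u_cont g)+
  have "integral {a..b} (\<lambda>t. \<phi> t *\<^sub>R g t) + integral {a..b} (\<lambda>t. deriv \<phi> t *\<^sub>R u t) = 0"
    using integral_unique[OF sum]
    by (simp add: Henstock_Kurzweil_Integration.integral_add integrable_continuous_real cont)
  then show "bochner_integral (lebesgue_on {a..b}) (\<lambda>t. deriv \<phi> t *\<^sub>R u t) =
      - bochner_integral (lebesgue_on {a..b}) (\<lambda>t. \<phi> t *\<^sub>R g t)"
    by (simp add: bochner_integral_eqI[OF bochner_has_integral_continuous[OF ab]] cont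
        eq_neg_iff_add_eq_0 add.commute)
qed

text \<open>The fundamental lemma of the calculus of variations for Banach space values. If the
  difference \<open>h\<close> were nonzero at an interior \<open>x\<close>, a bump supported where
  \<open>h\<close> is within half of \<open>norm (h x)\<close> of \<open>h x\<close> would have a
  nonzero integral against \<open>h\<close>.\<close>

lemma weak_derivative_unique:
  fixes u g1 g2 :: "real \<Rightarrow> 'a::banach"
  assumes ab: "a < b" and cont: "continuous_on {a..b} g1" "continuous_on {a..b} g2"
    and weak: "has_weak_derivative a b u g1" "has_weak_derivative a b u g2"
    and t: "t \<in> {a..b}"
  shows "g1 t = g2 t"
proof -
  define h where "h t = g1 t - g2 t" for t
  have h_cont: "continuous_on {a..b} h"
    unfolding h_def by (intro continuous_intros cont)
  have h_test: "integral {a..b} (\<lambda>t. \<phi> t *\<^sub>R h t) = 0" if \<phi>: "\<phi> \<in> test_functions a b" for \<phi>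
  proof -
    have c: "continuous_on {a..b} (\<lambda>t. \<phi> t *\<^sub>R g t)" if "continuous_on {a..b} g" for g :: "real \<Rightarrow> 'a"
      by (intro continuous_intros that test_functionD(2)[OF \<phi>])
    have "bochner_integral (lebesgue_on {a..b}) (\<lambda>t. \<phi> t *\<^sub>R g1 t)
        = bochner_integral (lebesgue_on {a..b}) (\<lambda>t. \<phi> t *\<^sub>R g2 t)"
      using weak \<phi> by (simp add: has_weak_derivative_def)
    then have "integral {a..b} (\<lambda>t. \<phi> t *\<^sub>R g1 t) = integral {a..b} (\<lambda>t. \<phi> t *\<^sub>R g2 t)"
      by (simp add: bochner_integral_eqI[OF bochner_has_integral_continuous[OF ab]] c cont)
    then show ?thesis
      by (simp add: h_def scaleR_diff_right Henstock_Kurzweil_Integration.integral_diff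
          integrable_continuous_real c cont)
  qed
  have interior: "h x = 0" if x: "x \<in> {a<..<b}" for x
  proof (rule ccontr)
    assume nz: "h x \<noteq> 0"
    define \<epsilon> where "\<epsilon> = norm (h x) / 2"
    have \<epsilon>: "0 < \<epsilon>" using nz by (simp add: \<epsilon>_def)
    obtain \<delta>0 where \<delta>0: "0 < \<delta>0" "\<And>y. y \<in> {a..b} \<Longrightarrow> dist y x < \<delta>0 \<Longrightarrow> dist (h y) (h x) < \<epsilon>"
      using h_cont[unfolded continuous_on_iff, rule_format, of x \<epsilon>] x \<epsilon> by auto
    \<comment> \<open>Halving the distances to \<open>a\<close> and \<open>b\<close> keeps the
      closed support of the bump inside the open interval.\<close>
    define \<delta> where "\<delta> = min \<delta>0 (min ((x - a) / 2) ((b - x) / 2))"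
    have \<delta>: "0 < \<delta>" "\<delta> \<le> \<delta>0" "\<delta> \<le> (x - a) / 2" "\<delta> \<le> (b - x) / 2"
    proof -
      have "0 < (x - a) / 2" "0 < (b - x) / 2" using x by auto
      then show "0 < \<delta>" "\<delta> \<le> \<delta>0" "\<delta> \<le> (x - a) / 2" "\<delta> \<le> (b - x) / 2"
        unfolding \<delta>_def using \<delta>0(1) by linarith+
    qed
    have "a < x - \<delta>" "x - \<delta> < x + \<delta>" "x + \<delta> < b"
      using \<delta> x by auto
    then obtain \<phi> where \<phi>: "\<phi> \<in> test_functions a b" "\<And>y. 0 \<le> \<phi> y"
      "\<And>y. y \<in> {x - \<delta><..<x + \<delta>} \<Longrightarrow> 0 < \<phi> y" "\<And>y. y \<notin> {x - \<delta><..<x + \<delta>} \<Longrightarrow> \<phi> y = 0"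
      by (rule bump_function) blast
    note \<phi>_cont = test_functionD(2)[OF \<phi>(1), of "{a..b}"]
    have "0 \<le> integral {a..b} \<phi>"
      using \<phi>(2) by (intro Henstock_Kurzweil_Integration.integral_nonneg integrable_continuous_real \<phi>_cont)
    moreover have "integral {a..b} \<phi> \<noteq> 0"
      using integral_eq_0_iff[OF \<phi>_cont ab \<phi>(2)] \<phi>(3)[of x] \<delta> x by force
    ultimately have pos: "0 < integral {a..b} \<phi>" by simp
    \<comment> \<open>The integral of \<phi> against \<open>h\<close> is 0, so it may be subtracted;
      only the oscillation of \<open>h\<close> near \<open>x\<close> is left.\<close>
    have "norm (integral {a..b} \<phi> *\<^sub>R h x) = norm (integral {a..b} (\<lambda>t. \<phi> t *\<^sub>R h x - \<phi> t *\<^sub>R h t))"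
    proof -
      have "integral {a..b} (\<lambda>t. \<phi> t *\<^sub>R h x) = integral {a..b} \<phi> *\<^sub>R h x"
        by (intro integral_unique has_integral_scaleR_left integrable_integral integrable_continuous_real \<phi>_cont)
      moreover have "integral {a..b} (\<lambda>t. \<phi> t *\<^sub>R h x - \<phi> t *\<^sub>R h t)
          = integral {a..b} (\<lambda>t. \<phi> t *\<^sub>R h x) - integral {a..b} (\<lambda>t. \<phi> t *\<^sub>R h t)"
        by (intro Henstock_Kurzweil_Integration.integral_diff integrable_continuous_real continuous_intros \<phi>_cont h_cont)
      ultimately show ?thesis by (simp add: h_test[OF \<phi>(1)])
    qed
    also have "\<dots> \<le> integral {a..b} (\<lambda>t. \<phi> t * \<epsilon>)"
    proof (rule integral_norm_bound_integral)
      fix t assume t: "t \<in> {a..b}"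
      show "norm (\<phi> t *\<^sub>R h x - \<phi> t *\<^sub>R h t) \<le> \<phi> t * \<epsilon>"
      proof (cases "t \<in> {x - \<delta><..<x + \<delta>}")
        case True
        then have "dist (h t) (h x) < \<epsilon>"
          using \<delta> t by (intro \<delta>0) (auto simp: dist_real_def)
        then show ?thesis
          using \<phi>(2)[of t]
          by (simp add: dist_norm norm_minus_commute mult_left_mono flip: scaleR_diff_right)
      qed (simp add: \<phi>(4))
    qed (intro integrable_continuous_real continuous_intros \<phi>_cont h_cont)+
    also have "\<dots> = integral {a..b} \<phi> * \<epsilon>"
      by simp
    finally show False
      using pos nz by (simp add: \<epsilon>_def)
  qed
  \<comment> \<open>Continuity carries the vanishing over to the endpoints.\<close>
  have "h t = 0"
  proof (rule continuous_constant_on_closure[of "{a<..<b}" h 0])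
    show "continuous_on (closure {a<..<b}) h" using h_cont ab by simp
  qed (use interior t ab in auto)
  then show ?thesis by (simp add: h_def)
qed

section \<open>Riemann--Liouville derivatives of Hoelder functions\<close>

text \<open>Clamping the argument to \<open>{t0..t1}\<close> does not increase distances, so it
  extends \<open>f\<close> to the line with the same constant \<open>H\<close>, and
  \<open>f t0 = 0\<close> makes the extension vanish left of \<open>t0\<close>. The kernels evaluate
  \<open>f\<close> on \<open>{t0..t1}\<close> only, so all results return from the extension to
  \<open>f\<close>.\<close>

lemma RL_derivative_Holder:
  fixes f :: "real \<Rightarrow> 'a::banach"
  assumes f: "\<forall>s\<in>{t0..t1}. \<forall>t\<in>{t0..t1}. norm (f s - f t) \<le> H * \<bar>s - t\<bar> powr \<beta>"
    and f0: "f t0 = 0" and t01: "t0 < t1" and \<alpha>: "0 < \<alpha>" "\<alpha> < \<beta>" "\<alpha> < 1" and H: "0 \<le> H"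
  shows "t \<in> {t0..t1} \<Longrightarrow> bochner_integrable (lebesgue_on {t0..t}) (Marchaud_kernel \<alpha> f t)"
    and "t \<in> {t0..t1} \<Longrightarrow> has_RL_derivative \<alpha> t0 t1 f (Marchaud_formula \<alpha> t0 f t) t"
    and "t \<in> {t0..t1} \<Longrightarrow> norm (Marchaud_formula \<alpha> t0 f t)
      \<le> H * ((\<alpha> / (\<beta> - \<alpha>) + 1) / Gamma (1 - \<alpha>)) * (t - t0) powr (\<beta> - \<alpha>)"
    and "continuous_on {t0..t1} (Marchaud_formula \<alpha> t0 f)"
proof -
  define c where "c s = max t0 (min t1 s)" for s
  have c: "c s \<in> {t0..t1}" "\<bar>c s - c t\<bar> \<le> \<bar>s - t\<bar>" for s t
    using t01 by (auto simp: c_def)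
  define h where "h s = f (c s)" for s
  have h_eq: "h s = f s" if "s \<in> {t0..t1}" for s
    using that by (auto simp: h_def c_def)
  have h0: "\<forall>s\<le>t0. h s = 0"
    using f0 t01 by (simp add: h_def c_def max_def)
  have h_Holder: "norm (h s - h t) \<le> H * \<bar>s - t\<bar> powr \<beta>" for s t
  proof -
    have "norm (h s - h t) \<le> H * \<bar>c s - c t\<bar> powr \<beta>"
      unfolding h_def using f c(1) by blast
    also have "\<dots> \<le> H * \<bar>s - t\<bar> powr \<beta>"
      using c(2) \<alpha> H by (intro mult_left_mono powr_mono2) auto
    finally show ?thesis .
  qed
  have L: "0 < t1 - t0" and t1: "t0 + (t1 - t0) = t1" using t01 by auto
  note core = fractional_derivative_Holder[OF h_Holder h0 \<alpha> L, unfolded t1]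
  have J_eq: "bochner_integrable (lebesgue_on {t0..t}) (J_kernel \<alpha> f t)
      \<longleftrightarrow> bochner_integrable (lebesgue_on {t0..t}) (J_kernel \<alpha> h t)"
    "bochner_integral (lebesgue_on {t0..t}) (J_kernel \<alpha> f t)
      = bochner_integral (lebesgue_on {t0..t}) (J_kernel \<alpha> h t)" if "t \<in> {t0..t1}" for t
    using that by (intro bochner_integral_cong; simp add: J_kernel_def h_eq)+
  have M_eq: "bochner_integrable (lebesgue_on {t0..t}) (Marchaud_kernel \<alpha> f t)
      \<longleftrightarrow> bochner_integrable (lebesgue_on {t0..t}) (Marchaud_kernel \<alpha> h t)"
    "bochner_integral (lebesgue_on {t0..t}) (Marchaud_kernel \<alpha> f t)
      = bochner_integral (lebesgue_on {t0..t}) (Marchaud_kernel \<alpha> h t)" if "t \<in> {t0..t1}" for t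
    using that by (intro bochner_integral_cong; simp add: Marchaud_kernel_def h_eq)+
  have formula: "Marchaud_formula \<alpha> t0 f t = (1 / Gamma (1 - \<alpha>)) *\<^sub>R Marchaud_derivative \<alpha> t0 h t"
    if "t \<in> {t0..t1}" for t
    using that by (simp only: Marchaud_formula_eq Marchaud_derivative_def M_eq h_eq)
  have RL: "RL_integral \<alpha> t0 f t
      = (1 / Gamma (1 - \<alpha>)) *\<^sub>R bochner_integral (lebesgue_on {t0..t}) (J_kernel \<alpha> h t)"
    if "t \<in> {t0..t1}" for t
    using that by (simp only: RL_integral_def J_eq)
  have Gamma_pos: "0 < Gamma (1 - \<alpha>)" using \<alpha> by (intro Gamma_real_pos) simp
  show "t \<in> {t0..t1} \<Longrightarrow> bochner_integrable (lebesgue_on {t0..t}) (Marchaud_kernel \<alpha> f t)"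
    using core(2) by (simp only: M_eq)
  show "has_RL_derivative \<alpha> t0 t1 f (Marchaud_formula \<alpha> t0 f t) t" if t: "t \<in> {t0..t1}"
    unfolding has_RL_derivative_def
  proof (intro conjI ballI)
    show "bochner_integrable (lebesgue_on {t0..\<tau>}) (J_kernel \<alpha> f \<tau>)" if "\<tau> \<in> {t0..t1}" for \<tau>
      using core(1)[OF that] that by (simp only: J_eq)
    have "((\<lambda>t. (1 / Gamma (1 - \<alpha>)) *\<^sub>R bochner_integral (lebesgue_on {t0..t}) (J_kernel \<alpha> h t))
        has_vector_derivative Marchaud_formula \<alpha> t0 f t) (at t within {t0..t1})"
      unfolding formula[OF t]
      by (rule bounded_linear.has_vector_derivative[OF bounded_linear_scaleR_right core(5)[OF t]])
    then show "(RL_integral \<alpha> t0 f has_vector_derivative Marchaud_formula \<alpha> t0 f t) (at t within {t0..t1})"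
      by (rule has_vector_derivative_transform[rotated 2]) (use t RL in auto)
  qed
  show "norm (Marchaud_formula \<alpha> t0 f t)
      \<le> H * ((\<alpha> / (\<beta> - \<alpha>) + 1) / Gamma (1 - \<alpha>)) * (t - t0) powr (\<beta> - \<alpha>)" if t: "t \<in> {t0..t1}"
    using divide_right_mono[OF core(3)[OF t], of "Gamma (1 - \<alpha>)"] Gamma_pos
    by (simp add: formula[OF t] field_simps)
  have "continuous_on {t0..t1} (\<lambda>t. (1 / Gamma (1 - \<alpha>)) *\<^sub>R Marchaud_derivative \<alpha> t0 h t)"
    by (intro continuous_intros core(4))
  then show "continuous_on {t0..t1} (Marchaud_formula \<alpha> t0 f)"
    by (rule continuous_on_eq) (simp only: formula)
qed

lemma Holder_space0_RL:
  fixes f :: "real \<Rightarrow> 'a::banach"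
  assumes f: "f \<in> Holder_space0 \<beta> t0 t1" and t01: "t0 < t1" and \<alpha>: "0 < \<alpha>" "\<alpha> < \<beta>" "\<alpha> < 1"
  shows "\<forall>t\<in>{t0..t1}. bochner_integrable (lebesgue_on {t0..t}) (Marchaud_kernel \<alpha> f t) \<and>
           has_RL_derivative \<alpha> t0 t1 f (Marchaud_formula \<alpha> t0 f t) t"
    and "has_RL_derivative \<alpha> t0 t1 f 0 t0"
    and "(Marchaud_formula \<alpha> t0 f \<longlongrightarrow> 0) (at_right t0)"
    and "is_cont_RL_derivative \<alpha> t0 t1 f (Marchaud_formula \<alpha> t0 f)"
    and "f \<in> RL_space \<alpha> t0 t1"
proof -
  obtain H where H: "0 < H" "\<forall>s\<in>{t0..t1}. \<forall>t\<in>{t0..t1}. norm (f s - f t) \<le> H * \<bar>s - t\<bar> powr \<beta>"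
    and f0: "f t0 = 0"
    using f by (auto simp: Holder_space0_def Holder_space_def)
  note RL = RL_derivative_Holder[OF H(2) f0 t01 \<alpha> less_imp_le[OF H(1)]]
  show deriv: "\<forall>t\<in>{t0..t1}. bochner_integrable (lebesgue_on {t0..t}) (Marchaud_kernel \<alpha> f t) \<and>
           has_RL_derivative \<alpha> t0 t1 f (Marchaud_formula \<alpha> t0 f t) t"
    using RL(1,2) by blast
  \<comment> \<open>The norm bound contains \<open>(t - t0) powr (\<beta> - \<alpha>)\<close>, which
    is 0 at \<open>t = t0\<close>.\<close>
  have "Marchaud_formula \<alpha> t0 f t0 = 0"
    using RL(3)[of t0] t01 by simp
  moreover have "(Marchaud_formula \<alpha> t0 f \<longlongrightarrow> Marchaud_formula \<alpha> t0 f t0) (at_right t0)"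
    by (rule continuous_on_Icc_at_rightD[OF RL(4) t01])
  moreover have "has_RL_derivative \<alpha> t0 t1 f (Marchaud_formula \<alpha> t0 f t0) t0"
    using t01 by (simp add: RL(2))
  ultimately show "has_RL_derivative \<alpha> t0 t1 f 0 t0"
    and "(Marchaud_formula \<alpha> t0 f \<longlongrightarrow> 0) (at_right t0)"
    by simp_all
  show "is_cont_RL_derivative \<alpha> t0 t1 f (Marchaud_formula \<alpha> t0 f)"
    unfolding is_cont_RL_derivative_def using RL(2,4)
    by (auto simp: has_RL_derivative_def intro!: has_weak_derivative_strong t01)
  moreover have "continuous_on {t0..t1} f"
    using H(2) \<alpha> by (intro Holder_continuous_on[of _ _ H \<beta>]) auto
  ultimately show "f \<in> RL_space \<alpha> t0 t1"
    by (auto simp: RL_space_def)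
qed

section \<open>Power functions as witnesses of strictness\<close>

text \<open>Comparing with the value 0 at \<open>s = t0\<close> would give
  \<open>norm v \<le> M * (t - t0) powr (\<beta> - \<gamma>)\<close>, whose right side tends to
  0.\<close>

lemma powr_not_Holder:
  assumes "t0 < t1" "\<gamma> < \<beta>" "v \<noteq> (0 :: 'a::banach)"
  shows "(\<lambda>t. (t - t0) powr \<gamma> *\<^sub>R v) \<notin> Holder_space \<beta> t0 t1"
proof
  assume "(\<lambda>t. (t - t0) powr \<gamma> *\<^sub>R v) \<in> Holder_space \<beta> t0 t1"
  then obtain M where M: "0 < M"
    "\<And>t s. t \<in> {t0..t1} \<Longrightarrow> s \<in> {t0..t1} \<Longrightarrow>
       norm ((t - t0) powr \<gamma> *\<^sub>R v - (s - t0) powr \<gamma> *\<^sub>R v) \<le> M * \<bar>t - s\<bar> powr \<beta>"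
    by (auto simp: Holder_space_def)
  have "norm v \<le> M * (t - t0) powr (\<beta> - \<gamma>)" if t: "t \<in> {t0<..<t1}" for t
  proof -
    have "(t - t0) powr \<gamma> * norm v \<le> M * (t - t0) powr \<beta>"
      using M(2)[of t t0] t by simp
    also have "\<dots> = (t - t0) powr \<gamma> * (M * (t - t0) powr (\<beta> - \<gamma>))"
      using t by (simp flip: powr_add)
    finally show ?thesis using t by simp
  qed
  then have "eventually (\<lambda>t. norm v \<le> M * (t - t0) powr (\<beta> - \<gamma>)) (at_right t0)"
    using eventually_at_right_real[OF assms(1)] by (rule eventually_mono[rotated]) auto
  moreover have "((\<lambda>t. M * (t - t0) powr (\<beta> - \<gamma>)) \<longlongrightarrow> 0) (at_right t0)"
  proof -
    have "((\<lambda>t. t - t0) \<longlongrightarrow> t0 - t0) (at_right t0)"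
      by (intro tendsto_intros)
    then have "((\<lambda>t. (t - t0) powr (\<beta> - \<gamma>)) \<longlongrightarrow> 0 powr (\<beta> - \<gamma>)) (at_right t0)"
      using assms(2) by (intro tendsto_powr') (auto simp: eventually_at_filter)
    from tendsto_mult[OF tendsto_const this, of M] show ?thesis by simp
  qed
  ultimately have "norm v \<le> 0"
    using tendsto_lowerbound trivial_limit_at_right_real by blast
  then show False using assms(3) by simp
qed

text \<open>Since \<open>u \<le> u powr p\<close> on the unit interval, the fractions
  \<open>x / (x + y)\<close> and \<open>y / (x + y)\<close>, which add up to 1, have
  \<open>p\<close>-th powers adding up to at least 1.\<close>

lemma powr_subadditive:
  fixes x y p :: real
  assumes "0 \<le> x" "0 \<le> y" "0 < p" "p \<le> 1"
  shows "(x + y) powr p \<le> x powr p + y powr p"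
proof (cases "x + y = 0")
  case False
  with assms have s: "0 < x + y" by simp
  have le: "u \<le> u powr p" if "0 \<le> u" "u \<le> 1" for u :: real
    using powr_mono'[of p 1 u] that assms by simp
  have "1 = x / (x + y) + y / (x + y)"
    using s by (simp flip: add_divide_distrib)
  also have "\<dots> \<le> (x / (x + y)) powr p + (y / (x + y)) powr p"
    using assms s by (intro add_mono le) auto
  also have "\<dots> = (x powr p + y powr p) / (x + y) powr p"
    using assms s by (simp add: powr_divide add_divide_distrib)
  finally show ?thesis using s by (simp add: field_simps)
qed (use assms in simp)

text \<open>Subadditivity applied to \<open>x = (x - y) + y\<close> bounds the increment of the
  power by the power of the increment.\<close>

lemma powr_Holder:
  fixes v :: "'a::banach"
  assumes "0 < \<gamma>" "\<gamma> \<le> 1"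
  shows "(\<lambda>t. (t - t0) powr \<gamma> *\<^sub>R v) \<in> Holder_space0 \<gamma> t0 t1"
proof -
  have mono: "\<bar>x powr \<gamma> - y powr \<gamma>\<bar> \<le> \<bar>x - y\<bar> powr \<gamma>" if "0 \<le> y" "y \<le> x" for x y :: real
    using powr_subadditive[of "x - y" y \<gamma>] powr_mono2[of \<gamma> y x] that assms by simp
  have "\<bar>x powr \<gamma> - y powr \<gamma>\<bar> \<le> \<bar>x - y\<bar> powr \<gamma>" if "0 \<le> y" "0 \<le> x" for x y :: real
    using mono[of x y] mono[of y x] that by (cases "y \<le> x") (auto simp: abs_minus_commute)
  \<comment> \<open>Adding 1 to \<open>norm v\<close> makes the Hoelder constant positive also for
    \<open>v = 0\<close>.\<close>
  then have "norm ((t - t0) powr \<gamma> *\<^sub>R v - (s - t0) powr \<gamma> *\<^sub>R v) \<le> (norm v + 1) * \<bar>t - s\<bar> powr \<gamma>"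
    if "t \<in> {t0..t1}" "s \<in> {t0..t1}" for s t
  proof -
    have "norm ((t - t0) powr \<gamma> *\<^sub>R v - (s - t0) powr \<gamma> *\<^sub>R v)
        = \<bar>(t - t0) powr \<gamma> - (s - t0) powr \<gamma>\<bar> * norm v"
      by (simp flip: scaleR_diff_left)
    also have "\<dots> \<le> \<bar>(t - t0) - (s - t0)\<bar> powr \<gamma> * (norm v + 1)"
      using that by (intro mult_mono \<open>\<And>y x. 0 \<le> y \<Longrightarrow> 0 \<le> x \<Longrightarrow> \<bar>x powr \<gamma> - y powr \<gamma>\<bar> \<le> \<bar>x - y\<bar> powr \<gamma>\<close>) auto
    finally show ?thesis by (simp add: mult.commute)
  qed
  moreover have "0 < norm v + 1"
    by (simp add: add_nonneg_pos)
  ultimately show ?thesis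
    unfolding Holder_space0_def Holder_space_def by auto
qed

section \<open>Norm estimates\<close>

text \<open>Membership in the space bounds the difference quotients, so their supremum is a genuine
  upper bound and thus itself a Hoelder constant. Estimates in terms of a constant \<open>H\<close>
  thereby become estimates in terms of the norm.\<close>

lemma Holder_seminorm:
  fixes f :: "real \<Rightarrow> 'a::banach"
  assumes f: "f \<in> Holder_space \<beta> t0 t1" and t01: "t0 < t1" and \<beta>: "0 < \<beta>"
  obtains H where "0 \<le> H" "Holder_norm \<beta> t0 t1 f = C0_norm t0 t1 f + H" "0 \<le> C0_norm t0 t1 f"
    "\<forall>s\<in>{t0..t1}. \<forall>t\<in>{t0..t1}. norm (f s - f t) \<le> H * \<bar>s - t\<bar> powr \<beta>"
proof -
  define P where "P = {(t, s). t \<in> {t0..t1} \<and> s \<in> {t0..t1} \<and> t \<noteq> s}"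
  define q where "q = (\<lambda>(t, s). norm (f t - f s) / \<bar>t - s\<bar> powr \<beta>)"
  define H where "H = (SUP z\<in>P. q z)"
  obtain M where M: "0 < M"
    "\<And>t s. t \<in> {t0..t1} \<Longrightarrow> s \<in> {t0..t1} \<Longrightarrow> norm (f t - f s) \<le> M * \<bar>t - s\<bar> powr \<beta>"
    using f by (auto simp: Holder_space_def)
  have "bdd_above (q ` P)"
    using M by (intro bdd_aboveI[of _ M]) (auto simp: P_def q_def divide_le_eq)
  then have q_le: "q z \<le> H" if "z \<in> P" for z
    unfolding H_def using that by (intro cSUP_upper)
  have "0 \<le> q (t0, t1)" by (simp add: q_def)
  also have "\<dots> \<le> H" using t01 by (intro q_le) (simp add: P_def)
  finally have H: "0 \<le> H" .
  have "norm (f s - f t) \<le> H * \<bar>s - t\<bar> powr \<beta>" if "s \<in> {t0..t1}" "t \<in> {t0..t1}" for s t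
  proof (cases "s = t")
    case False
    then show ?thesis
      using q_le[of "(s, t)"] that by (simp add: P_def q_def divide_le_eq)
  qed simp
  moreover have "0 \<le> C0_norm t0 t1 f"
  proof -
    have "continuous_on {t0..t1} f"
      using M(2) \<beta> by (intro Holder_continuous_on[of _ _ M \<beta>]) auto
    then have "bdd_above ((\<lambda>t. norm (f t)) ` {t0..t1})"
      by (intro bounded_imp_bdd_above compact_imp_bounded compact_continuous_image continuous_intros) auto
    then have "norm (f t0) \<le> C0_norm t0 t1 f"
      unfolding C0_norm_def using t01 by (intro cSUP_upper) auto
    then show ?thesis using norm_ge_zero order_trans by blast
  qed
  moreover have "Holder_norm \<beta> t0 t1 f = C0_norm t0 t1 f + H"
    by (simp add: Holder_norm_def H_def P_def q_def)
  ultimately show ?thesis using that H by blast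
qed

text \<open>Uniqueness of the continuous weak derivative on \<open>{t0..t1}\<close> removes the
  arbitrary choice made by \<open>SOME\<close>.\<close>

lemma RL_norm_eq:
  assumes "is_cont_RL_derivative \<alpha> t0 t1 f g" "t0 < t1"
  shows "RL_norm \<alpha> t0 t1 f = C0_norm t0 t1 f + C0_norm t0 t1 g"
proof -
  define g' where "g' = (SOME g. is_cont_RL_derivative \<alpha> t0 t1 f g)"
  have "is_cont_RL_derivative \<alpha> t0 t1 f g'"
    unfolding g'_def using assms(1) by (rule someI[of "is_cont_RL_derivative \<alpha> t0 t1 f"])
  then have "g' t = g t" if "t \<in> {t0..t1}" for t
    using assms that weak_derivative_unique[OF assms(2)] unfolding is_cont_RL_derivative_def by blast
  then have "C0_norm t0 t1 g' = C0_norm t0 t1 g"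
    unfolding C0_norm_def by (intro SUP_cong) auto
  then show ?thesis
    by (simp add: RL_norm_def g'_def)
qed

lemma RL_norm_le_Holder_norm:
  fixes f :: "real \<Rightarrow> 'a::banach"
  assumes f: "f \<in> Holder_space0 \<beta> t0 t1" and t01: "t0 < t1" and \<alpha>: "0 < \<alpha>" "\<alpha> < \<beta>" "\<alpha> < 1"
  shows "RL_norm \<alpha> t0 t1 f
    \<le> (1 + (\<alpha> / (\<beta> - \<alpha>) + 1) / Gamma (1 - \<alpha>) * (t1 - t0) powr (\<beta> - \<alpha>)) * Holder_norm \<beta> t0 t1 f"
proof -
  define K where "K = (\<alpha> / (\<beta> - \<alpha>) + 1) / Gamma (1 - \<alpha>)"
  have K: "0 \<le> K" using \<alpha> by (simp add: K_def Gamma_real_nonneg)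
  obtain H where H: "0 \<le> H" "Holder_norm \<beta> t0 t1 f = C0_norm t0 t1 f + H" "0 \<le> C0_norm t0 t1 f"
    "\<forall>s\<in>{t0..t1}. \<forall>t\<in>{t0..t1}. norm (f s - f t) \<le> H * \<bar>s - t\<bar> powr \<beta>"
    using Holder_seminorm[of f \<beta> t0 t1] f t01 \<alpha> unfolding Holder_space0_def by force
  have f0: "f t0 = 0" using f by (simp add: Holder_space0_def)
  have "C0_norm t0 t1 (Marchaud_formula \<alpha> t0 f) \<le> H * (K * (t1 - t0) powr (\<beta> - \<alpha>))"
    unfolding C0_norm_def
  proof (rule cSUP_least)
    fix t assume t: "t \<in> {t0..t1}"
    have "norm (Marchaud_formula \<alpha> t0 f t) \<le> H * K * (t - t0) powr (\<beta> - \<alpha>)"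
      unfolding K_def by (rule RL_derivative_Holder(3)[OF H(4) f0 t01 \<alpha> H(1) t])
    also have "\<dots> \<le> H * K * (t1 - t0) powr (\<beta> - \<alpha>)"
      using t \<alpha> H(1) K by (intro mult_left_mono powr_mono2) auto
    finally show "norm (Marchaud_formula \<alpha> t0 f t) \<le> H * (K * (t1 - t0) powr (\<beta> - \<alpha>))"
      by (simp add: mult.assoc)
  qed (use t01 in simp)
  \<comment> \<open>The derivative is controlled by the seminorm alone; adding the supremum norm
    turns it into the full Hoelder norm.\<close>
  also have "\<dots> \<le> (C0_norm t0 t1 f + H) * (K * (t1 - t0) powr (\<beta> - \<alpha>))"
    using H(3) K by (intro mult_right_mono) auto
  finally have "RL_norm \<alpha> t0 t1 f \<le> C0_norm t0 t1 f + (C0_norm t0 t1 f + H) * (K * (t1 - t0) powr (\<beta> - \<alpha>))"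
    by (simp add: RL_norm_eq[OF Holder_space0_RL(4)[OF f t01 \<alpha>] t01])
  also have "\<dots> \<le> (C0_norm t0 t1 f + H) + (C0_norm t0 t1 f + H) * (K * (t1 - t0) powr (\<beta> - \<alpha>))"
    using H(1) by simp
  also have "\<dots> = (1 + K * (t1 - t0) powr (\<beta> - \<alpha>)) * Holder_norm \<beta> t0 t1 f"
    unfolding H(2) by (simp add: algebra_simps)
  finally show ?thesis by (simp add: K_def)
qed

theorem theorem18:
  fixes t0 t1 \<alpha> \<beta> :: real
  assumes "(UNIV :: 'a::banach set) \<noteq> {0}"
    and "t0 < t1" and "0 < \<alpha>" and "\<alpha> < \<beta>" and "\<beta> < 1"
  shows "(\<forall>f \<in> (Holder_space0 \<beta> t0 t1 :: (real \<Rightarrow> 'a) set).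
            (\<forall>t\<in>{t0..t1}. \<exists>D. has_RL_derivative \<alpha> t0 t1 f D t) \<and>
            (\<forall>t\<in>{t0<..t1}.
               bochner_integrable (lebesgue_on {t0..t}) (Marchaud_kernel \<alpha> f t) \<and>
               has_RL_derivative \<alpha> t0 t1 f (Marchaud_formula \<alpha> t0 f t) t) \<and>
            has_RL_derivative \<alpha> t0 t1 f 0 t0 \<and>
            (Marchaud_formula \<alpha> t0 f \<longlongrightarrow> 0) (at_right t0)) \<and>
         (Holder_space0 \<beta> t0 t1 :: (real \<Rightarrow> 'a) set) \<subset> RL_space \<alpha> t0 t1 \<and>
         (\<exists>M>0. \<forall>f \<in> (Holder_space0 \<beta> t0 t1 :: (real \<Rightarrow> 'a) set).
            RL_norm \<alpha> t0 t1 f \<le> M * Holder_norm \<beta> t0 t1 f)"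
proof (intro conjI ballI)
  have \<alpha>1: "\<alpha> < 1" using assms by simp
  note RL = Holder_space0_RL[OF _ assms(2-4) \<alpha>1]
  {
    fix f :: "real \<Rightarrow> 'a" assume f: "f \<in> Holder_space0 \<beta> t0 t1"
    show "\<exists>D. has_RL_derivative \<alpha> t0 t1 f D t" if "t \<in> {t0..t1}" for t
      using RL(1)[OF f] that by blast
    show "bochner_integrable (lebesgue_on {t0..t}) (Marchaud_kernel \<alpha> f t)"
      "has_RL_derivative \<alpha> t0 t1 f (Marchaud_formula \<alpha> t0 f t) t" if "t \<in> {t0<..t1}" for t
      using RL(1)[OF f] that by auto
    show "has_RL_derivative \<alpha> t0 t1 f 0 t0" "(Marchaud_formula \<alpha> t0 f \<longlongrightarrow> 0) (at_right t0)"
      by (rule RL(2,3)[OF f])+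
  }
  show "(Holder_space0 \<beta> t0 t1 :: (real \<Rightarrow> 'a) set) \<subset> RL_space \<alpha> t0 t1"
  proof (rule psubsetI)
    show "(Holder_space0 \<beta> t0 t1 :: (real \<Rightarrow> 'a) set) \<subseteq> RL_space \<alpha> t0 t1"
      using RL(5) by blast
    obtain v :: 'a where v: "v \<noteq> 0" using assms(1) by auto
    obtain \<gamma> where \<gamma>: "\<alpha> < \<gamma>" "\<gamma> < \<beta>" using assms(4) dense by blast
    let ?f = "\<lambda>t. (t - t0) powr \<gamma> *\<^sub>R v"
    have "?f \<in> Holder_space0 \<gamma> t0 t1"
      using \<gamma> assms by (intro powr_Holder) auto
    then have "?f \<in> RL_space \<alpha> t0 t1"
      using Holder_space0_RL(5) assms(2,3) \<gamma>(1) \<alpha>1 by blast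
    moreover have "?f \<notin> Holder_space0 \<beta> t0 t1"
      using powr_not_Holder[OF assms(2) \<gamma>(2) v] by (simp add: Holder_space0_def)
    ultimately show "(Holder_space0 \<beta> t0 t1 :: (real \<Rightarrow> 'a) set) \<noteq> RL_space \<alpha> t0 t1"
      by blast
  qed
  \<comment> \<open>The factor from \<open>RL_norm_le_Holder_norm\<close>; its summand 1, which
    accounts for the supremum norm of \<open>f\<close>, makes it positive.\<close>
  define M where "M = 1 + (\<alpha> / (\<beta> - \<alpha>) + 1) / Gamma (1 - \<alpha>) * (t1 - t0) powr (\<beta> - \<alpha>)"
  have "0 < M"
    using assms Gamma_real_nonneg[of "1 - \<alpha>"] by (auto simp: M_def intro!: add_pos_nonneg)
  moreover have "\<forall>f \<in> (Holder_space0 \<beta> t0 t1 :: (real \<Rightarrow> 'a) set).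
      RL_norm \<alpha> t0 t1 f \<le> M * Holder_norm \<beta> t0 t1 f"
    unfolding M_def using RL_norm_le_Holder_norm[OF _ assms(2-4) \<alpha>1] by blast
  ultimately show "\<exists>M>0. \<forall>f \<in> (Holder_space0 \<beta> t0 t1 :: (real \<Rightarrow> 'a) set).
      RL_norm \<alpha> t0 t1 f \<le> M * Holder_norm \<beta> t0 t1 f"
    by blast
qed

end
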